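(* Let $H\in(0,1)$ and let $G^H=\{G^H_k,\,k\ge1\}$ be fractional Gaussian noise with Hurst index $H$. Let $r(1)=\operatorname{Var}(G^H_1)$ and $r(k)=\operatorname{Var}[G^H_k\mid G^H_1,\dots,G^H_{k-1}]$ for $k\ge2$, and let $\sigma^2_{\rm inov}(G^H)=\lim_{n\to\infty}r(n)$ (this limit exists since $r(k)$ is deterministic, nonnegative and nonincreasing). Then $$\sigma^2_{\rm inov}(G^H)\ \ge\ \frac{\Gamma\!\left(\frac32-H\right)}{\Gamma\!\left(H+\frac12\right)\Gamma(2-2H)} .$$
   Context: Fractional Gaussian noise: $G^H_k=B^H_k-B^H_{k-1}$, $k=1,2,\dots$, where $B^H$ is a fractional Brownian motion, i.e. a centered Gaussian process with $\mathsf E B^H_tB^H_s=\frac12(|t|^{2H}+|s|^{2H}-|t-s|^{2H})$. It is a stationary centered Gaussian sequence with $\mathsf E G^H_1G^H_{k+1}=\frac12((k+1)^{2H}-2k^{2H}+(k-1)^{2H})$ for $k\ge1$ and $\operatorname{Var}G^H_1=1$. Conditional variances of Gaussian variables given other jointly Gaussian variables are nonrandom. *)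

theory Defs
  imports "HOL-Probability.Probability"
begin

definition centered_gaussian_rv :: "'a measure \<Rightarrow> ('a \<Rightarrow> real) \<Rightarrow> bool" where
  "centered_gaussian_rv M X \<longleftrightarrow> X \<in> borel_measurable M \<and>
     (\<exists>v::real. v \<ge> 0 \<and>
        char (distr M borel X) = (\<lambda>t. complex_of_real (exp (- v * t\<^sup>2 / 2))))"

definition fBm :: "'a measure \<Rightarrow> real \<Rightarrow> (real \<Rightarrow> 'a \<Rightarrow> real) \<Rightarrow> bool" where
  "fBm M H B \<longleftrightarrow>
     (\<forall>(n::nat) (c::nat \<Rightarrow> real) (t::nat \<Rightarrow> real).
        centered_gaussian_rv M (\<lambda>\<omega>. \<Sum>j<n. c j * B (t j) \<omega>)) \<and>
     (\<forall>s t. prob_space.expectation M (\<lambda>\<omega>. B t \<omega> * B s \<omega>)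
              = (\<bar>t\<bar> powr (2*H) + \<bar>s\<bar> powr (2*H) - \<bar>t - s\<bar> powr (2*H)) / 2)"

text \<open>Fractional Gaussian noise G k = B k - B (k-1), k \<ge> 1 (index 0 unused).\<close>
definition fGn :: "(real \<Rightarrow> 'a \<Rightarrow> real) \<Rightarrow> nat \<Rightarrow> 'a \<Rightarrow> real" where
  "fGn B k = (\<lambda>\<omega>. B (real k) \<omega> - B (real k - 1) \<omega>)"

definition gen_sigma :: "'a measure \<Rightarrow> 'i set \<Rightarrow> ('i \<Rightarrow> 'a \<Rightarrow> real) \<Rightarrow> 'a measure" where
  "gen_sigma M I X = sigma (space M) {X i -` A \<inter> space M | i A. i \<in> I \<and> A \<in> sets borel}"

definition cond_var :: "'a measure \<Rightarrow> 'a measure \<Rightarrow> ('a \<Rightarrow> real) \<Rightarrow> 'a \<Rightarrow> real" where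
  "cond_var M F X = real_cond_exp M F (\<lambda>\<omega>. (X \<omega> - real_cond_exp M F X \<omega>)\<^sup>2)"

end

theory Submission
  imports Defs "HOL-Real_Asymp.Real_Asymp"
begin

text \<open>By Gaussianity the conditional expectation of \<open>G\<^sub>k\<close> given its past is a linear projection,
  so \<open>r(k)\<close> is the least mean square error of linear prediction of \<open>G\<^sub>k\<close> from \<open>G\<^sub>1, \<dots>, G\<^sub>k\<^sub>-\<^sub>1\<close>;
  by stationarity it is nonincreasing. The Mandelbrot--Van Ness kernels
  \<open>K\<^sub>t(u) = (t-u)\<^sub>+\<close> to the power \<open>a = H - 1/2\<close> satisfy
  \<open>\<parallel>K\<^sub>t - K\<^sub>s\<parallel>\<^sup>2 = V \<bar>t-s\<bar>\<close> to the power \<open>2H\<close>, so the error of any linear predictor is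
  \<open>1/V\<close> times the squared \<open>L\<^sup>2\<close>-norm of a combination of kernel increments. On \<open>(k-1, k)\<close> only
  \<open>K\<^sub>k\<close> is nonzero, which gives the lower bound \<open>1/(2H V)\<close>, and \<open>V\<close> reduces to a Beta integral.\<close>

section \<open>The Mandelbrot--Van Ness kernel\<close>

lemma powr_plus_nat:
  fixes b x y :: real assumes "0 < b"
  shows "y = x + real n \<Longrightarrow> b powr y = b powr x * b ^ n"
    and "y = 2 * x + real n \<Longrightarrow> b powr y = (b powr x)\<^sup>2 * b ^ n"
  using assms by (simp_all add: powr_add powr_realpow powr_power mult.commute)

lemma powr_increment_bound:
  fixes a u :: real assumes "a < 1" "0 < u"
  shows "\<bar>(1 + u) powr a - u powr a\<bar> \<le> \<bar>a\<bar> * u powr (a - 1)"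
proof -
  have "\<exists>z>u. z < 1 + u \<and> (1+u) powr a - u powr a = (1 + u - u) * (a * z powr (a - 1))"
    by (rule MVT2) (use assms in \<open>auto intro!: derivative_eq_intros\<close>)
  then obtain z where z: "u < z" "(1+u) powr a - u powr a = a * z powr (a-1)" by auto
  moreover have "z powr (a-1) \<le> u powr (a-1)" using z(1) assms by (intro powr_mono2') auto
  ultimately show ?thesis by (simp add: abs_mult mult_left_mono)
qed

text \<open>Up to the factor \<^term>\<open>2*a+1\<close>, an antiderivative of
  \<^term>\<open>((1+u) powr a - u powr a)\<^sup>2\<close> modulo a Beta integrand: integrating
  \<^term>\<open>u powr a * (1+u) powr a\<close> by parts twice lowers the exponent of \<^term>\<open>1+u\<close> to
  \<^term>\<open>a-2\<close>, where the integral over the half-line converges for every \<^term>\<open>a\<close> with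
  \<^term>\<open>\<bar>a\<bar> < 1/2\<close>, whatever its sign.\<close>
definition frac_primitive :: "real \<Rightarrow> real \<Rightarrow> real" where
  "frac_primitive a u = (1+u) powr (2*a+1) + u powr (2*a+1) - 2 * u powr (a+1) * (1+u) powr a
     - u powr (a+1) * (1+u) powr (a-1)"

text \<open>The leading terms grow like \<open>u powr (2*a+1)\<close>, so their cancellation has to
  be made explicit: the expression regroups into two nonnegative summands, each of order
  \<open>u powr (2*a-1)\<close> by the mean value theorem, and \<open>2*a-1 < 0\<close>.\<close>

lemma frac_primitive_at_top:
  fixes a :: real
  assumes "-1/2 < a" "a < 1/2"
  shows "(frac_primitive a \<longlongrightarrow> 0) at_top"
proof (rule Lim_null_comparison)
  show "((\<lambda>u. a\<^sup>2 * u powr (2*a-1) + (a+1) * u powr (2*a-1)) \<longlongrightarrow> 0) at_top"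
    by (intro tendsto_add_zero tendsto_mult_right_zero tendsto_neg_powr filterlim_ident) (use assms in auto)
  show "\<forall>\<^sub>F u in at_top. norm (frac_primitive a u) \<le> a\<^sup>2 * u powr (2*a-1) + (a+1) * u powr (2*a-1)"
    using eventually_gt_at_top[of 0]
  proof eventually_elim
    case (elim u)
    \<comment> \<open>All powers become polynomials in \<open>p\<close>, \<open>q\<close> and
      \<open>u\<close>, so the regrouping \<open>F\<close> is a polynomial identity.\<close>
    define p q where "p = (1+u) powr (a-1)" and "q = u powr a"
    have e: "(1+u) powr a = p * (1+u)" "(1+u) powr (2*a+1) = p^2 * (1+u)^3" "(1+u) powr (a+1) = p * (1+u)^2"
      unfolding p_def using elim powr_plus_nat(1)[of "1+u" a "a-1" 1]
        powr_plus_nat(2)[of "1+u" "2*a+1" "a-1" 3] powr_plus_nat(1)[of "1+u" "a+1" "a-1" 2]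
      by simp_all
    have e2: "u powr (a+1) = q*u" "u powr (2*a+1) = q^2 * u"
      using elim by (auto simp: q_def powr_add powr_power)
    have F: "frac_primitive a u = u * ((1+u) powr a - u powr a)^2
       + (1+u) powr (a-1) * ((1+u) powr (a+1) - u powr (a+1))"
      unfolding frac_primitive_def e e2 p_def[symmetric] q_def[symmetric] by algebra
    have "u * ((1+u) powr a - u powr a)^2 \<le> u * (\<bar>a\<bar> * u powr (a - 1))^2"
      using powr_increment_bound[of a u] assms elim
      by (intro mult_left_mono) (auto simp: abs_le_square_iff[symmetric] abs_mult)
    also have "\<dots> = a^2 * (u * u powr (2*a-2))"
      using elim by (simp add: power_mult_distrib powr_power algebra_simps)
    also have "u * u powr (2*a-2) = u powr (2*a-1)"
      using elim by (simp add: powr_mult_base)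
    finally have 1: "u * ((1+u) powr a - u powr a)^2 \<le> a^2 * u powr (2*a-1)" .
    have "\<exists>z>u. z < 1 + u \<and> (1+u) powr (a+1) - u powr (a+1) = (1 + u - u) * ((a+1) * z powr a)"
      by (rule MVT2) (use assms elim in \<open>auto intro!: derivative_eq_intros\<close>)
    then obtain z where z: "u < z" "z < 1 + u" "(1+u) powr (a+1) - u powr (a+1) = (a+1) * z powr a" by auto
    \<comment> \<open>Moving \<open>1+u\<close> down to \<open>z\<close> merges both factors into
      one power with the negative exponent \<open>2*a-1\<close>; a direct bound on
      \<open>z powr a\<close> would depend on the sign of \<open>a\<close>.\<close>
    have "(1+u) powr (a-1) * z powr a \<le> z powr (a-1) * z powr a"
      using z elim assms by (intro mult_right_mono powr_mono2') auto
    also have "\<dots> = z powr (2*a-1)" by (simp flip: powr_add)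
    also have "\<dots> \<le> u powr (2*a-1)" using z elim assms by (intro powr_mono2') auto
    finally have "(a+1) * ((1+u) powr (a-1) * z powr a) \<le> (a+1) * u powr (2*a-1)"
      using assms by (intro mult_left_mono) auto
    moreover have "0 \<le> (a+1) * ((1+u) powr (a-1) * z powr a)" using assms by simp
    moreover have "0 \<le> u * ((1+u) powr a - u powr a)^2" using elim by simp
    moreover have "frac_primitive a u = u * ((1+u) powr a - u powr a)^2 + (a+1) * ((1+u) powr (a-1) * z powr a)"
      unfolding F z(3) by (simp add: mult_ac)
    ultimately show ?case using 1 by simp
  qed
qed

lemma frac_primitive_at_right_0:
  fixes a :: real
  assumes "-1/2 < a" "a < 1/2"
  shows "(frac_primitive a \<longlongrightarrow> 1) (at_right 0)"
  using assms unfolding frac_primitive_def by real_asymp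

text \<open>Over the lowest power \<open>(1+u) powr (a-2)\<close> and \<open>u powr a\<close>, the
  derivative given by the product rule is a polynomial expression, and completing the square
  isolates the Beta integrand.\<close>

lemma frac_primitive_has_derivative:
  fixes a u :: real
  assumes "0 < u"
  shows "(frac_primitive a
   has_real_derivative (2*a+1) * ((1+u) powr a - u powr a)\<^sup>2 - (1-a) * (u powr a * (1+u) powr (a-2))) (at u)"
proof -
  define p q where "p = (1+u) powr (a-2)" and "q = u powr a"
  have e: "(1+u) powr (a-1) = p * (1+u)" "(1+u) powr a = p * (1+u)\<^sup>2" "(1+u) powr (2*a) = p^2 * (1+u)^4"
    unfolding p_def using assms powr_plus_nat(1)[of "1+u" "a-1" "a-2" 1]
      powr_plus_nat(1)[of "1+u" a "a-2" 2] powr_plus_nat(2)[of "1+u" "2*a" "a-2" 4]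
    by simp_all
  have e2: "u powr (a+1) = q*u" "u powr (2*a) = q^2"
    using assms by (auto simp: q_def powr_add powr_power)
  have d: "((\<lambda>u. u powr c) has_real_derivative c * u powr (c-1)) (at u)"
    "((\<lambda>u. (1+u) powr c) has_real_derivative c * (1+u) powr (c-1)) (at u)" for c
    using assms by (auto intro!: derivative_eq_intros)
  have "(frac_primitive a has_real_derivative
      ((2*a+1) * (1+u) powr (2*a+1-1) + (2*a+1) * u powr (2*a+1-1)
      - (2 * ((a+1) * u powr (a+1-1)) * (1+u) powr a + (a * (1+u) powr (a-1)) * (2 * u powr (a+1)))
      - ((a+1) * u powr (a+1-1) * (1+u) powr (a-1) + (a-1) * (1+u) powr (a-1-1) * u powr (a+1)))) (at u)"
    unfolding frac_primitive_def by (intro DERIV_add DERIV_diff DERIV_mult DERIV_cmult d)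
  also have "((2*a+1) * (1+u) powr (2*a+1-1) + (2*a+1) * u powr (2*a+1-1)
      - (2 * ((a+1) * u powr (a+1-1)) * (1+u) powr a + (a * (1+u) powr (a-1)) * (2 * u powr (a+1)))
      - ((a+1) * u powr (a+1-1) * (1+u) powr (a-1) + (a-1) * (1+u) powr (a-1-1) * u powr (a+1)))
    = (2*a+1) * (p^2 * (1+u)^4) + (2*a+1) * q^2 - (2 * ((a+1) * q) * (p * (1+u)^2) + (a * (p * (1+u))) * (2 * (q * u)))
      - ((a+1) * q * (p * (1+u)) + (a-1) * p * (q * u))"
    using e e2 by (simp add: p_def q_def)
  also have "\<dots> = (2*a+1) * (p * (1+u)^2 - q)\<^sup>2 - (1-a) * (q * p)" by algebra
  also have "\<dots> = (2*a+1) * ((1+u) powr a - u powr a)\<^sup>2 - (1-a) * (u powr a * (1+u) powr (a-2))"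
    unfolding e p_def[symmetric] q_def[symmetric] ..
  finally show ?thesis .
qed

section \<open>The incomplete Beta function and the substitution \<open>u/(1+u)\<close>\<close>

definition incomplete_beta :: "real \<Rightarrow> real \<Rightarrow> real" where
  "incomplete_beta a x = integral {0..x} (\<lambda>t. t powr a * (1 - t) powr (-2*a))"

lemma incomplete_beta_at_1:
  assumes "-1/2 < a" "a < 1/2"
  shows "(\<lambda>t. t powr a * (1 - t) powr (-2*a)) integrable_on {0..1::real}" "incomplete_beta a 1 = Beta (a+1) (1-2*a)"
  using has_integral_Beta_real[of "a+1" "1-2*a"] assms unfolding incomplete_beta_def
  by (auto simp: has_integral_iff)

lemma continuous_on_incomplete_beta:
  assumes "-1/2 < a" "a < 1/2"
  shows "continuous_on {0..1} (incomplete_beta a)"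
  unfolding incomplete_beta_def by (intro indefinite_integral_continuous_1 incomplete_beta_at_1 assms)

text \<open>With \<open>t = u/(1+u)\<close> one has \<open>1 - t = 1/(1+u)\<close> and
  \<open>dt = du/(1+u)^2\<close>. This carries the Beta integrand with parameters \<open>a+1\<close>
  and \<open>1-2*a\<close> to the remainder in \<open>frac_primitive_has_derivative\<close>, up to
  the factor \<open>1-a\<close>.\<close>

lemma incomplete_beta_substitution_has_derivative:
  fixes a u :: real
  assumes "-1/2 < a" "a < 1/2" "0 < u"
  shows "((\<lambda>u. incomplete_beta a (u/(1+u))) has_real_derivative u powr a * (1+u) powr (a-2)) (at u)"
proof -
  define x where "x = u/(1+u)"
  have x: "0 < x" "x < 1" "1 - x = 1 / (1+u)" using assms by (auto simp: x_def field_simps)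
  have c: "isCont (\<lambda>t. t powr a * (1 - t) powr (-2*a)) x"
    using x by (intro continuous_mult continuous_at_within_powr continuous_intros) auto
  have "(incomplete_beta a has_vector_derivative (x powr a * (1 - x) powr (-2*a))) (at x within ({0..1} - {}))"
    unfolding incomplete_beta_def[abs_def] using x
    by (intro integral_has_vector_derivative_continuous_at incomplete_beta_at_1 assms) (use continuous_at_imp_continuous_within[OF c, of "{0..1}"] in auto)
  then have "(incomplete_beta a has_real_derivative (x powr a * (1 - x) powr (-2*a))) (at x within {0..1})"
    by (simp add: has_real_derivative_iff_has_vector_derivative)
  moreover have "at x within {0..1} = at x" using x by (intro at_within_interior) auto
  ultimately have d: "(incomplete_beta a has_real_derivative (x powr a * (1 - x) powr (-2*a))) (at x)" by simp
  have "((\<lambda>u. u/(1+u)) has_real_derivative 1/(1+u)^2) (at u)"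
    using assms
    by (auto intro!: derivative_eq_intros simp: power2_eq_square)
  from DERIV_chain2[OF d[unfolded x_def] this]
  have "((\<lambda>u. incomplete_beta a (u/(1+u))) has_real_derivative x powr a * (1 - x) powr (-2*a) * (1/(1+u)^2)) (at u)"
    by (simp add: x_def)
  also have "x powr a * (1 - x) powr (-2*a) * (1/(1+u)^2) = u powr a * ((1+u) powr (-a) * (1+u) powr (2*a) * (1+u) powr (-2))"
  proof -
    have "x powr a = u powr a * (1+u) powr (-a)"
      using assms by (simp add: x_def powr_divide powr_minus field_simps)
    moreover have "(1 - x) powr (-2*a) = (1+u) powr (2*a)"
      unfolding x(3) using assms by (simp add: powr_divide powr_minus)
    moreover have "1/(1+u)^2 = (1+u) powr (-2)"
      using assms by (simp add: powr_minus field_simps)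
    ultimately show ?thesis by (simp only: mult_ac)
  qed
  also have "\<dots> = u powr a * (1+u) powr (a-2)" using assms by (simp flip: powr_add)
  finally show ?thesis .
qed

text \<open>In the derivative of \<open>frac_primitive\<close> plus \<open>1-a\<close> times the
  substituted incomplete Beta function, the Beta terms cancel. The fundamental theorem on the open
  half-line needs only the boundary limits; the limit 1 of \<open>frac_primitive\<close> at 0
  produces the \<open>- 1\<close>.\<close>

lemma powr_increment_square_integral:
  fixes a :: real
  assumes "-1/2 < a" "a < 1/2"
  shows "has_bochner_integral lborel (\<lambda>u. indicator {0<..} u * ((1+u) powr a - u powr a)\<^sup>2)
     (((1-a) * Beta (a+1) (1-2*a) - 1) / (2*a+1))"
proof -
  let ?P = "\<lambda>u. (frac_primitive a u + (1-a) * incomplete_beta a (u/(1+u))) / (2*a+1)"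
  let ?f = "\<lambda>u. ((1+u) powr a - u powr a)\<^sup>2"
  have ne: "2*a+1 \<noteq> 0" using assms by simp
  have D: "(?P has_real_derivative ?f u) (at u)" if "0 < u" for u
  proof -
    have "(?P has_real_derivative ((2*a+1) * ?f u - (1-a) * (u powr a * (1+u) powr (a-2)) + (1-a) * (u powr a * (1+u) powr (a-2))) / (2*a+1)) (at u)"
      by (intro DERIV_cdivide DERIV_add frac_primitive_has_derivative DERIV_cmult incomplete_beta_substitution_has_derivative assms that)
    then show ?thesis using ne by simp
  qed
  have T0: "(?P \<longlongrightarrow> (1 + (1-a) * incomplete_beta a 0) / (2*a+1)) (at_right 0)"
  proof (intro tendsto_intros frac_primitive_at_right_0 assms ne)
    \<comment> \<open>Continuity of \<open>incomplete_beta\<close> is known on \<open>{0..1}\<close>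
      only, so here and at infinity the substitution must approach the endpoint from inside the
      interval.\<close>
    have "filterlim (\<lambda>u::real. u/(1+u)) (at 0 within {0..1}) (at_right 0)"
      unfolding filterlim_at
      by (auto simp: eventually_at_right_field intro!: exI[of _ 1] tendsto_eq_intros)
    moreover have "(incomplete_beta a \<longlongrightarrow> incomplete_beta a 0) (at 0 within {0..1})"
      using continuous_on_incomplete_beta[OF assms] by (auto simp: continuous_on_def)
    ultimately show "((\<lambda>u. incomplete_beta a (u/(1+u))) \<longlongrightarrow> incomplete_beta a 0) (at_right 0)"
      by (rule filterlim_compose[rotated])
  qed
  have T1: "(?P \<longlongrightarrow> (0 + (1-a) * incomplete_beta a 1) / (2*a+1)) at_top"
  proof (intro tendsto_intros frac_primitive_at_top assms ne)
    have "((\<lambda>u::real. u/(1+u)) \<longlongrightarrow> 1) at_top" by real_asymp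
    then have "filterlim (\<lambda>u::real. u/(1+u)) (at 1 within {0..1}) at_top"
      unfolding filterlim_at
      by (auto intro!: eventually_mono[OF eventually_gt_at_top[of 0]])
    moreover have "(incomplete_beta a \<longlongrightarrow> incomplete_beta a 1) (at 1 within {0..1})"
      using continuous_on_incomplete_beta[OF assms] by (auto simp: continuous_on_def)
    ultimately show "((\<lambda>u. incomplete_beta a (u/(1+u))) \<longlongrightarrow> incomplete_beta a 1) at_top"
      by (rule filterlim_compose[rotated])
  qed
  have e: "einterval 0 \<infinity> = {0::real<..}" by (auto simp: einterval_def zero_ereal_def)
  have "set_integrable lborel (einterval 0 \<infinity>) ?f" "(LBINT u=0..\<infinity>. ?f u) = (0 + (1-a) * incomplete_beta a 1) / (2*a+1) - (1 + (1-a) * incomplete_beta a 0) / (2*a+1)"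
  proof -
    have 1: "((?P \<circ> real_of_ereal) \<longlongrightarrow> (1 + (1-a) * incomplete_beta a 0) / (2*a+1)) (at_right (ereal 0))"
      unfolding ereal_tendsto_simps by (rule T0)
    have 2: "((?P \<circ> real_of_ereal) \<longlongrightarrow> (0 + (1-a) * incomplete_beta a 1) / (2*a+1)) (at_left \<infinity>)"
      unfolding ereal_tendsto_simps by (rule T1)
    have 3: "isCont ?f u" if "0 < u" for u using that by (auto intro!: continuous_intros)
    note I = interval_integral_FTC_nonneg[where F="?P" and f="?f" and a=0 and b="\<infinity>", OF _ _ _ _ 1[unfolded zero_ereal_def[symmetric]] 2]
    show "set_integrable lborel (einterval 0 \<infinity>) ?f"
      by (rule I(1)) (use D 3 in \<open>auto simp: zero_ereal_def\<close>)
    show "(LBINT u=0..\<infinity>. ?f u) = (0 + (1-a) * incomplete_beta a 1) / (2*a+1) - (1 + (1-a) * incomplete_beta a 0) / (2*a+1)"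
      by (rule I(2)) (use D 3 in \<open>auto simp: zero_ereal_def\<close>)
  qed
  moreover have "incomplete_beta a 0 = 0" by (simp add: incomplete_beta_def)
  ultimately show ?thesis
    using incomplete_beta_at_1(2)[OF assms] ne
    by (simp add: has_bochner_integral_iff interval_lebesgue_integral_0_infty e set_integrable_def
      set_lebesgue_integral_def mult.commute diff_divide_distrib)
qed

section \<open>Inner products of kernel increments\<close>

lemma powr_integral_unit:
  fixes p :: real
  assumes "-1 < p"
  shows "has_bochner_integral lborel (\<lambda>y. indicator {0<..<1} y * y powr p) (1 / (p+1))"
proof -
  let ?F = "\<lambda>y::real. y powr (p+1) / (p+1)"
  have 1: "((?F \<circ> real_of_ereal) \<longlongrightarrow> 0) (at_right (ereal 0))"
    unfolding ereal_tendsto_simps using assms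
    by (auto intro!: tendsto_eq_intros eventually_at_rightI[of 0 1])
  have 2: "((?F \<circ> real_of_ereal) \<longlongrightarrow> 1/(p+1)) (at_left (ereal 1))"
    unfolding ereal_tendsto_simps using assms by (auto intro!: tendsto_eq_intros)
  have D: "(?F has_real_derivative u powr p) (at u)" if "0 < u" for u
    using that assms by (auto intro!: derivative_eq_intros)
  have 3: "isCont (\<lambda>y. y powr p) u" if "0 < u" for u using that by (auto intro!: continuous_intros)
  note I = interval_integral_FTC_nonneg[where F="?F" and f="\<lambda>y. y powr p" and a=0 and b="1",
       OF _ _ _ _ 1[unfolded zero_ereal_def[symmetric]] 2[unfolded one_ereal_def[symmetric]]]
  have "set_integrable lborel (einterval 0 1) (\<lambda>y. y powr p)" "(LBINT y=0..1. y powr p) = 1/(p+1) - 0"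
  proof -
    show "set_integrable lborel (einterval 0 1) (\<lambda>y. y powr p)"
      by (rule I(1)) (use D 3 in \<open>auto simp: zero_ereal_def\<close>)
    show "(LBINT y=0..1. y powr p) = 1/(p+1) - 0"
      by (rule I(2)) (use D 3 in \<open>auto simp: zero_ereal_def\<close>)
  qed
  moreover have "einterval 0 1 = {0<..<1::real}" by (auto simp: einterval_def zero_ereal_def one_ereal_def)
  ultimately show ?thesis
    by (simp add: has_bochner_integral_iff interval_lebesgue_integral_def set_integrable_def
      set_lebesgue_integral_def mult.commute)
qed

text \<open>The Mandelbrot--Van Ness kernel; \<^term>\<open>0 powr a = 0\<close> makes it vanish for
  \<^term>\<open>u \<ge> t\<close> even when \<^term>\<open>a\<close> is not positive.\<close>
definition mvn_kernel :: "real \<Rightarrow> real \<Rightarrow> real \<Rightarrow> real" where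
  "mvn_kernel a t u = (max 0 (t - u)) powr a"

text \<open>This is the constant \<open>V\<close> of the overview, the squared norm of a unit kernel
  increment, with the Beta function already expanded into Gamma functions.\<close>

definition mvn_const :: "real \<Rightarrow> real" where
  "mvn_const a = Gamma (a+1) * Gamma (1-2*a) / ((2*a+1) * Gamma (1-a))"

text \<open>After the reflection \<open>u\<close> to \<open>-u\<close> both kernels are active on
  the positive half-line, while on \<open>(-1, 0)\<close> only the one at time 1 is. The latter part
  contributes \<open>1/(2*a+1)\<close>, which cancels the boundary term of
  \<open>powr_increment_square_integral\<close>.\<close>

lemma mvn_kernel_unit_increment:
  fixes a :: real
  assumes "-1/2 < a" "a < 1/2"
  shows "has_bochner_integral lborel (\<lambda>u. (mvn_kernel a 1 u - mvn_kernel a 0 u)\<^sup>2) (mvn_const a)"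
proof -
  have c: "((1-a) * Beta (a+1) (1-2*a) - 1) / (2*a+1) + 1 / (2*a+1) = mvn_const a"
  proof -
    have "Gamma (2 - a) = (1-a) * Gamma (1-a)"
      using Gamma_plus1[of "1-a"] assms by (simp add: nonpos_Ints_def)
    then show ?thesis using assms by (simp add: Beta_def mvn_const_def divide_simps)
  qed
  have "has_bochner_integral lborel (\<lambda>y. indicator {0<..<1} (1+1*y) * (1+1*y) powr (2*a)) (1 / (2*a+1) /\<^sub>R \<bar>1\<bar>)"
    using powr_integral_unit[of "2*a"] assms lborel_has_bochner_integral_real_affine_iff[of 1 "\<lambda>y. indicator {0<..<1} y * y powr (2*a)" "1 / (2*a+1)" 1]
    by (simp del: scaleR_conv_of_real)
  then have "has_bochner_integral lborel (\<lambda>y. indicator {-1<..<0} y * (1+y) powr (2*a)) (1 / (2*a+1))"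
    by (rule has_bochner_integral_cong[THEN iffD1, rotated 3]) (auto simp: indicator_def)
  from has_bochner_integral_add[OF powr_increment_square_integral[OF assms] this]
  have "has_bochner_integral lborel (\<lambda>u. indicator {0<..} u * ((1+u) powr a - u powr a)\<^sup>2 + indicator {-1<..<0} u * (1+u) powr (2*a)) (mvn_const a)"
    unfolding c .
  also have "?this \<longleftrightarrow> has_bochner_integral lborel (\<lambda>u. (mvn_kernel a 1 (-u) - mvn_kernel a 0 (-u))\<^sup>2) (mvn_const a)"
  proof (rule has_bochner_integral_cong_AE)
    \<comment> \<open>The point 0 is a genuine exception: both indicators vanish there, but the
      kernel at time 1 equals 1.\<close>
    show "AE u in lborel. indicator {0<..} u * ((1+u) powr a - u powr a)\<^sup>2 + indicator {-1<..<0} u * (1+u) powr (2*a)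
       = (mvn_kernel a 1 (-u) - mvn_kernel a 0 (-u))\<^sup>2"
      using AE_lborel_singleton[of 0]
      by eventually_elim (auto simp: mvn_kernel_def indicator_def max_def powr_power mult.commute)
  qed (auto simp: mvn_kernel_def)
  finally show ?thesis
    by (subst lborel_has_bochner_integral_real_affine_iff[where c="-1" and t=0]) simp_all
qed

text \<open>Scaling: under \<open>u = s + d*y\<close> with \<open>d = t - s\<close> the kernels are
  homogeneous of degree \<open>a\<close>, so the square yields \<open>d powr (2*a)\<close> and the
  change of variable one more factor \<open>d\<close>.\<close>

lemma mvn_kernel_increment_less:
  fixes a s t :: real
  assumes "-1/2 < a" "a < 1/2" "s < t"
  shows "has_bochner_integral lborel (\<lambda>u. (mvn_kernel a t u - mvn_kernel a s u)\<^sup>2) ((t-s) powr (2*a+1) * mvn_const a)"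
proof -
  define d where "d = t - s"
  have d: "0 < d" using assms by (simp add: d_def)
  have m: "mvn_kernel a t (s + d*y) = d powr a * mvn_kernel a 1 y"
     "mvn_kernel a s (s + d*y) = d powr a * mvn_kernel a 0 y" for y
  proof -
    have "max 0 (t - (s + d*y)) = d * max 0 (1-y)" "max 0 (s - (s + d*y)) = d * max 0 (0 - y)"
      using d by (simp_all add: max_mult_distrib_left) (simp_all add: d_def algebra_simps)
    then show "mvn_kernel a t (s + d*y) = d powr a * mvn_kernel a 1 y"
     "mvn_kernel a s (s + d*y) = d powr a * mvn_kernel a 0 y"
      using d by (simp_all add: mvn_kernel_def powr_mult)
  qed
  have e: "(mvn_kernel a t (s + d*y) - mvn_kernel a s (s + d*y))\<^sup>2 = d powr (2*a) * (mvn_kernel a 1 y - mvn_kernel a 0 y)\<^sup>2" for y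
    unfolding m right_diff_distrib[symmetric] power_mult_distrib using d by (simp add: powr_power mult.commute)
  have "has_bochner_integral lborel (\<lambda>y. (mvn_kernel a t (s + d*y) - mvn_kernel a s (s + d*y))\<^sup>2) (d powr (2*a) * mvn_const a)"
    unfolding e by (intro has_bochner_integral_mult_right mvn_kernel_unit_increment assms)
  moreover have "d powr (2*a) * mvn_const a = (d powr (2*a+1) * mvn_const a) /\<^sub>R \<bar>d\<bar>"
    using d by (simp add: powr_add)
  ultimately show ?thesis
    using d unfolding d_def[symmetric]
    by (subst lborel_has_bochner_integral_real_affine_iff[where c=d and t=s]) simp_all
qed

lemma mvn_kernel_increment:
  fixes a s t :: real
  assumes "-1/2 < a" "a < 1/2"
  shows "has_bochner_integral lborel (\<lambda>u. (mvn_kernel a t u - mvn_kernel a s u)\<^sup>2) (\<bar>t-s\<bar> powr (2*a+1) * mvn_const a)"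
proof (cases s t rule: linorder_cases)
  case greater
  then show ?thesis using mvn_kernel_increment_less[OF assms, of t s] by (simp add: power2_commute abs_minus_commute)
qed (use mvn_kernel_increment_less[OF assms, of s t] in auto)

text \<open>Polarisation. A single kernel is not square integrable at minus infinity, so the product
  is written through four squared increments instead of squares of kernels.\<close>

lemma mvn_kernel_increment_product:
  fixes a s t s' t' :: real
  assumes "-1/2 < a" "a < 1/2"
  shows "has_bochner_integral lborel (\<lambda>u. (mvn_kernel a t u - mvn_kernel a s u) * (mvn_kernel a t' u - mvn_kernel a s' u))
    (mvn_const a * ((\<bar>t-s'\<bar> powr (2*a+1) + \<bar>s-t'\<bar> powr (2*a+1) - \<bar>t-t'\<bar> powr (2*a+1) - \<bar>s-s'\<bar> powr (2*a+1)) / 2))"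
proof -
  let ?K = "mvn_kernel a"
  have "has_bochner_integral lborel (\<lambda>u. ((?K t u - ?K s' u)\<^sup>2 + (?K s u - ?K t' u)\<^sup>2 - (?K t u - ?K t' u)\<^sup>2 - (?K s u - ?K s' u)\<^sup>2) / 2)
    ((\<bar>t-s'\<bar> powr (2*a+1) * mvn_const a + \<bar>s-t'\<bar> powr (2*a+1) * mvn_const a - \<bar>t-t'\<bar> powr (2*a+1) * mvn_const a - \<bar>s-s'\<bar> powr (2*a+1) * mvn_const a) / 2)"
    by (intro has_bochner_integral_divide_zero has_bochner_integral_diff has_bochner_integral_add mvn_kernel_increment assms)
  also have "(\<lambda>u. ((?K t u - ?K s' u)\<^sup>2 + (?K s u - ?K t' u)\<^sup>2 - (?K t u - ?K t' u)\<^sup>2 - (?K s u - ?K s' u)\<^sup>2) / 2)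
     = (\<lambda>u. (?K t u - ?K s u) * (?K t' u - ?K s' u))"
    by (intro ext) (simp add: power2_eq_square field_simps)
  finally show ?thesis by (simp add: algebra_simps)
qed

lemma mvn_kernel_increment_quadratic_form:
  fixes a :: real and t s c :: "'i \<Rightarrow> real"
  assumes "-1/2 < a" "a < 1/2"
    and "finite J"
  shows "has_bochner_integral lborel (\<lambda>u. (\<Sum>j\<in>J. c j * (mvn_kernel a (t j) u - mvn_kernel a (s j) u))\<^sup>2)
    (mvn_const a * (\<Sum>i\<in>J. \<Sum>j\<in>J. c i * c j * ((\<bar>t i-s j\<bar> powr (2*a+1) + \<bar>s i-t j\<bar> powr (2*a+1) - \<bar>t i-t j\<bar> powr (2*a+1) - \<bar>s i-s j\<bar> powr (2*a+1)) / 2)))"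
proof -
  have e: "(\<lambda>u. (\<Sum>j\<in>J. c j * (mvn_kernel a (t j) u - mvn_kernel a (s j) u))\<^sup>2) =
    (\<lambda>u. \<Sum>i\<in>J. \<Sum>j\<in>J. c i * c j * ((mvn_kernel a (t i) u - mvn_kernel a (s i) u) * (mvn_kernel a (t j) u - mvn_kernel a (s j) u)))"
    by (auto simp: power2_eq_square sum_product mult_ac intro!: sum.cong)
  show ?thesis
    unfolding e sum_distrib_left
    by (intro has_bochner_integral_sum)
       (subst mult.left_commute, intro has_bochner_integral_mult_right mvn_kernel_increment_product assms)
qed

lemma mvn_const_pos: "-1/2 < a \<Longrightarrow> a < 1/2 \<Longrightarrow> 0 < mvn_const a"
  unfolding mvn_const_def by (intro divide_pos_pos mult_pos_pos Gamma_real_pos) auto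

text \<open>By \<open>mvn_kernel_increment_quadratic_form\<close>, \<open>mvn_const a\<close> times
  the form is the integral of a square. On the unit interval before \<open>t i\<close> every kernel
  except the one at \<open>t i\<close> vanishes, so whatever the other coefficients are, the
  integrand there is \<open>(t i - u) powr (2*a)\<close>; elsewhere it is bounded below by
  0.\<close>

lemma mvn_quadratic_form_lower_bound:
  fixes a :: real and t s c :: "'i \<Rightarrow> real"
  assumes "-1/2 < a" "a < 1/2"
    and "finite J" and i: "i \<in> J" "c i = 1" "s i = t i - 1"
    and j: "\<And>j. j \<in> J \<Longrightarrow> j \<noteq> i \<Longrightarrow> t j \<le> t i - 1 \<and> s j \<le> t i - 1"
  shows "1/((2*a+1) * mvn_const a) \<le> (\<Sum>i\<in>J. \<Sum>j\<in>J. c i * c j * ((\<bar>t i-s j\<bar> powr (2*a+1) + \<bar>s i-t j\<bar> powr (2*a+1) - \<bar>t i-t j\<bar> powr (2*a+1) - \<bar>s i-s j\<bar> powr (2*a+1)) / 2))"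
  (is "_ \<le> ?Q")
proof -
  have 1: "has_bochner_integral lborel (\<lambda>u. indicator {0<..<1} (t i - u) * (t i - u) powr (2*a)) (1 / (2*a+1))"
    using powr_integral_unit[of "2*a"] assms(1,2) lborel_has_bochner_integral_real_affine_iff[of "-1" "\<lambda>y. indicator {0<..<1} y * y powr (2*a)" "1 / (2*a+1)" "t i"]
    by (simp del: scaleR_conv_of_real)
  have "1/(2*a+1) \<le> mvn_const a * ?Q"
  proof -
    note 2 = mvn_kernel_increment_quadratic_form[OF assms(1,2,3), where c=c and t=t and s=s]
    have "(LBINT u. indicator {0<..<1} (t i - u) * (t i - u) powr (2*a))
      \<le> (LBINT u. (\<Sum>j\<in>J. c j * (mvn_kernel a (t j) u - mvn_kernel a (s j) u))\<^sup>2)"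
    proof (intro integral_mono)
      show "integrable lborel (\<lambda>u. indicator {0<..<1} (t i - u) * (t i - u) powr (2*a))"
        using 1 by (rule integrable.intros)
      show "integrable lborel (\<lambda>u. (\<Sum>j\<in>J. c j * (mvn_kernel a (t j) u - mvn_kernel a (s j) u))\<^sup>2)"
        using 2 by (rule integrable.intros)
      fix u
      show "indicator {0<..<1} (t i - u) * (t i - u) powr (2*a)
        \<le> (\<Sum>j\<in>J. c j * (mvn_kernel a (t j) u - mvn_kernel a (s j) u))\<^sup>2"
      proof (cases "0 < t i - u \<and> t i - u < 1")
        case True
        have "(\<Sum>j\<in>J. c j * (mvn_kernel a (t j) u - mvn_kernel a (s j) u))
          = (\<Sum>j\<in>J. if j = i then (t i - u) powr a else 0)"
          by (intro sum.cong refl) (use True i j in \<open>force simp: mvn_kernel_def max_def\<close>)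
        also have "\<dots> = (t i - u) powr a" using i assms by simp
        finally show ?thesis using True by (simp add: powr_power mult.commute)
      qed auto
    qed
    then show ?thesis using 1 2 by (simp add: has_bochner_integral_iff)
  qed
  moreover have "1 / (x * m) \<le> q" if "1 / x \<le> m * q" "0 < x" "0 < m" for x m q :: real
    using that by (simp add: field_simps)
  ultimately show ?thesis
    using mvn_const_pos[of a] assms(1,2) by simp
qed

lemma mvn_const_eq:
  assumes "0 < H" "H < 1"
  shows "1/((2*(H-1/2)+1) * mvn_const (H-1/2)) = Gamma (3/2 - H) / (Gamma (H + 1/2) * Gamma (2 - 2*H))"
  using assms by (simp add: mvn_const_def algebra_simps)

section \<open>Conditional variances in Gaussian families\<close>

lemma gaussian_distr:
  assumes "prob_space M" "X \<in> borel_measurable M" "0 \<le> v"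
    and "char (distr M borel X) = (\<lambda>t. complex_of_real (exp (- v * t\<^sup>2 / 2)))"
  shows "distr M borel X = distr std_normal_distribution borel (\<lambda>x. sqrt v * x)"
proof (rule Levy_uniqueness)
  interpret prob_space M by fact
  interpret N: real_distribution std_normal_distribution by (rule real_dist_normal_dist)
  show "real_distribution (distr M borel X)" using assms(2) by (rule real_distribution_distr)
  show "real_distribution (distr std_normal_distribution borel (\<lambda>x. sqrt v * x))"
    by (rule N.real_distribution_distr) simp
  show "char (distr M borel X) = char (distr std_normal_distribution borel (\<lambda>x. sqrt v * x))"
  proof
    fix t
    have "char (distr std_normal_distribution borel (\<lambda>x. sqrt v * x)) t = char std_normal_distribution (t * sqrt v)"
      by (simp add: char_def integral_distr mult.assoc)
    also have "\<dots> = char (distr M borel X) t"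
      using assms(3) by (simp add: assms(4) char_std_normal_distribution power_mult_distrib mult.commute)
    finally show "char (distr M borel X) t = char (distr std_normal_distribution borel (\<lambda>x. sqrt v * x)) t" ..
  qed
qed

text \<open>The law is that of \<open>sqrt v\<close> times a standard normal variable, degenerate
  case \<open>v = 0\<close> included, so moments are transported from there. This identifies the
  existentially quantified \<open>v\<close> with the second moment.\<close>

lemma gaussian_moments:
  assumes "prob_space M" "centered_gaussian_rv M X"
  shows "X \<in> borel_measurable M" "integrable M (\<lambda>\<omega>. (X \<omega>)\<^sup>2)" "integrable M X" "integral\<^sup>L M X = 0"
    "(CLINT \<omega>|M. iexp (X \<omega>)) = complex_of_real (exp (- (LINT \<omega>|M. (X \<omega>)\<^sup>2) / 2))"
proof -
  interpret prob_space M by fact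
  from assms(2) obtain v where X[measurable]: "X \<in> borel_measurable M" and v: "0 \<le> v"
      "char (distr M borel X) = (\<lambda>t. complex_of_real (exp (- v * t\<^sup>2 / 2)))"
    unfolding centered_gaussian_rv_def by blast
  show "X \<in> borel_measurable M" by fact
  note D = gaussian_distr[OF assms(1) X v]
  have I: "integrable M (\<lambda>\<omega>. f (X \<omega>)) \<longleftrightarrow> integrable std_normal_distribution (\<lambda>x. f (sqrt v * x))"
    "(LINT \<omega>|M. f (X \<omega>)) = (LINT x|std_normal_distribution. f (sqrt v * x))"
    if [measurable]: "f \<in> borel_measurable borel" for f :: "real \<Rightarrow> real"
    using arg_cong[OF D, of "\<lambda>N. integrable N f"] arg_cong[OF D, of "\<lambda>N. integral\<^sup>L N f"]
    by (simp_all add: integrable_distr_eq integral_distr)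
  have sq: "(LINT \<omega>|M. (X \<omega>)\<^sup>2) = v"
    using I(2)[of "\<lambda>x. x\<^sup>2"] std_normal_distribution_even_moments(1)[of 1] v
    by (simp add: power_mult_distrib)
  show "integrable M (\<lambda>\<omega>. (X \<omega>)\<^sup>2)"
    using I(1)[of "\<lambda>x. x\<^sup>2"] std_normal_distribution_even_moments(2)[of 1] v
    by (simp add: power_mult_distrib)
  show "integrable M X"
    using I(1)[of "\<lambda>x. x"] integrable_std_normal_distribution_moment[of 1] v by simp
  show "integral\<^sup>L M X = 0"
    using I(2)[of "\<lambda>x. x"] integral_std_normal_distribution_moment_odd[of 1] v by simp
  show "(CLINT \<omega>|M. iexp (X \<omega>)) = complex_of_real (exp (- (LINT \<omega>|M. (X \<omega>)\<^sup>2) / 2))"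
    using fun_cong[OF v(2), of 1] unfolding sq by (simp add: char_def integral_distr)
qed

text \<open>Uniqueness of characteristic functions for the signed measure with density
  \<open>Z\<close>, transported by \<open>X\<close>.\<close>

lemma real_weight_char_zero:
  fixes Z X :: "'a \<Rightarrow> real"
  assumes Z: "integrable M Z" and X[measurable]: "X \<in> borel_measurable M"
    and *: "\<And>t. (CLINT \<omega>|M. Z \<omega> * iexp (t * X \<omega>)) = 0"
    and A[measurable]: "A \<in> sets borel"
  shows "(LINT \<omega>|M. Z \<omega> * indicator A (X \<omega>)) = 0"
proof -
  \<comment> \<open>after normalisation, the positive and negative parts of \<open>Z\<close> are densities of two probability
    measures under which \<open>X\<close> has the same characteristic function\<close>
  define p q where "p = (\<lambda>\<omega>. max 0 (Z \<omega>))" and "q = (\<lambda>\<omega>. max 0 (- Z \<omega>))"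
  have [measurable]: "Z \<in> borel_measurable M" using Z by auto
  have pq: "integrable M p" "integrable M q" "\<And>\<omega>. 0 \<le> p \<omega>" "\<And>\<omega>. 0 \<le> q \<omega>" "\<And>\<omega>. Z \<omega> = p \<omega> - q \<omega>"
    using Z by (auto simp: p_def q_def)
  have [measurable]: "p \<in> borel_measurable M" "q \<in> borel_measurable M" by (auto simp: p_def q_def)
  have ip: "integrable M (\<lambda>\<omega>. complex_of_real (f \<omega>) * iexp (t * X \<omega>))" if "integrable M f" for f t
    using that by (rule Bochner_Integration.integrable_bound[OF integrable_norm]) (use that in \<open>auto simp: norm_mult\<close>)
  have eq: "(CLINT \<omega>|M. p \<omega> * iexp (t * X \<omega>)) = (CLINT \<omega>|M. q \<omega> * iexp (t * X \<omega>))" for t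
    using *[of t] pq ip by (simp add: left_diff_distrib)
  define m where "m = integral\<^sup>L M p"
  \<comment> \<open>The frequency \<open>t = 0\<close> shows that both parts have the same mass, so
    one normalising constant serves both.\<close>
  have mq: "m = integral\<^sup>L M q"
    using eq[of 0] pq by (simp add: m_def)
  have m0: "0 \<le> m" unfolding m_def using pq by simp
  show ?thesis
  proof (cases "m = 0")
    case True
    then have "AE \<omega> in M. p \<omega> = 0" "AE \<omega> in M. q \<omega> = 0"
      using mq pq integral_nonneg_eq_0_iff_AE[of M p] integral_nonneg_eq_0_iff_AE[of M q] unfolding m_def by auto
    then have "AE \<omega> in M. Z \<omega> * indicator A (X \<omega>) = 0" by eventually_elim (simp add: pq(5))
    then show ?thesis by (rule integral_eq_zero_AE)
  next
    case False
    with m0 have m: "0 < m" by simp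
    define N where "N f = density M (\<lambda>\<omega>. ennreal (f \<omega> / m))" for f :: "'a \<Rightarrow> real"
    have ps: "prob_space (N f)" if f: "integrable M f" "\<And>\<omega>. 0 \<le> f \<omega>" "integral\<^sup>L M f = m" for f
    proof
      have [measurable]: "f \<in> borel_measurable M" using f by auto
      have "emeasure (N f) (space (N f)) = (\<integral>\<^sup>+\<omega>. ennreal (f \<omega> / m) \<partial>M)"
        by (simp add: N_def emeasure_density cong: nn_integral_cong)
      also have "\<dots> = ennreal (LINT \<omega>|M. f \<omega> / m)"
        using f m by (intro nn_integral_eq_integral) auto
      finally show "emeasure (N f) (space (N f)) = 1" using f m by simp
    qed
    have [measurable]: "X \<in> borel_measurable (N f)" for f by (simp add: N_def)
    have rd: "real_distribution (distr (N f) borel X)" if f: "integrable M f" "\<And>\<omega>. 0 \<le> f \<omega>" "integral\<^sup>L M f = m" for f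
      using prob_space.real_distribution_distr[OF ps[OF f]] by simp
    have int: "integral\<^sup>L (N f) g = (\<integral>\<omega>. (f \<omega> / m) *\<^sub>R g \<omega> \<partial>M)"
      if "f \<in> borel_measurable M" "g \<in> borel_measurable M" "\<And>\<omega>. 0 \<le> f \<omega>" for f and g :: "'a \<Rightarrow> 'b::{banach, second_countable_topology}"
      unfolding N_def using that m by (intro integral_density) auto
    have "distr (N p) borel X = distr (N q) borel X"
    proof (rule Levy_uniqueness[OF rd rd])
      show "char (distr (N p) borel X) = char (distr (N q) borel X)"
        using eq pq by (simp add: char_def integral_distr int scaleR_conv_of_real fun_eq_iff)
    qed (use pq mq in \<open>auto simp: m_def\<close>)
    moreover have "(LINT x|distr (N f) borel X. indicator A x :: real) = (LINT \<omega>|N f. indicator A (X \<omega>))" for f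
      by (rule integral_distr) auto
    ultimately have "(LINT \<omega>|N p. indicator A (X \<omega>) :: real) = (LINT \<omega>|N q. indicator A (X \<omega>))"
      by metis
    then have "(LINT \<omega>|M. p \<omega> * indicator A (X \<omega>)) = (LINT \<omega>|M. q \<omega> * indicator A (X \<omega>))"
      using pq m by (simp add: int)
    moreover have "integrable M (\<lambda>\<omega>. f \<omega> * indicator A (X \<omega>))" if "integrable M f" for f :: "'a \<Rightarrow> real"
      using that by (rule Bochner_Integration.integrable_bound) (use that in \<open>auto simp: indicator_def\<close>)
    ultimately show ?thesis using pq by (simp add: left_diff_distrib)
  qed
qed

text \<open>Conjugation with \<open>t\<close> replaced by \<open>-t\<close> gives the hypothesis for
  \<open>cnj Z\<close>, hence for the real and imaginary parts. Complex weights arise because the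
  induction over coordinates below absorbs exponentials into the weight.\<close>

lemma complex_weight_char_zero:
  fixes Z :: "'a \<Rightarrow> complex" and X :: "'a \<Rightarrow> real"
  assumes Z: "integrable M Z" and X[measurable]: "X \<in> borel_measurable M"
    and *: "\<And>t. (CLINT \<omega>|M. Z \<omega> * iexp (t * X \<omega>)) = 0"
    and A[measurable]: "A \<in> sets borel"
  shows "(CLINT \<omega>|M. Z \<omega> * indicator A (X \<omega>)) = 0"
proof -
  have [measurable]: "Z \<in> borel_measurable M" using Z by auto
  have iz: "integrable M (\<lambda>\<omega>. W \<omega> * iexp (t * X \<omega>))" if "integrable M W" for W :: "'a \<Rightarrow> complex" and t
    using that by (rule Bochner_Integration.integrable_bound[OF integrable_norm]) (use that in \<open>auto simp: norm_mult\<close>)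
  have cnj: "(CLINT \<omega>|M. cnj (Z \<omega>) * iexp (t * X \<omega>)) = 0" for t
  proof -
    have "(CLINT \<omega>|M. cnj (Z \<omega>) * iexp (t * X \<omega>)) = (CLINT \<omega>|M. cnj (Z \<omega> * iexp ((-t) * X \<omega>)))"
      by (simp add: exp_cnj)
    also have "\<dots> = cnj (CLINT \<omega>|M. Z \<omega> * iexp ((-t) * X \<omega>))" by (rule Bochner_Integration.integral_cnj)
    finally show ?thesis using *[of "-t"] by simp
  qed
  have Re: "(CLINT \<omega>|M. Re (Z \<omega>) * iexp (t * X \<omega>)) = 0" for t
  proof -
    have "(\<lambda>\<omega>. Re (Z \<omega>) * iexp (t * X \<omega>)) = (\<lambda>\<omega>. (Z \<omega> * iexp (t * X \<omega>) + cnj (Z \<omega>) * iexp (t * X \<omega>)) / 2)"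
      by (auto simp: fun_eq_iff complex_add_cnj simp flip: distrib_right)
    then show ?thesis using *[of t] cnj[of t] iz[OF Z, of t] iz[of "\<lambda>\<omega>. cnj (Z \<omega>)" t] Z by simp
  qed
  have Im: "(CLINT \<omega>|M. Im (Z \<omega>) * iexp (t * X \<omega>)) = 0" for t
  proof -
    have "(\<lambda>\<omega>. Im (Z \<omega>) * iexp (t * X \<omega>)) = (\<lambda>\<omega>. (Z \<omega> * iexp (t * X \<omega>) - cnj (Z \<omega>) * iexp (t * X \<omega>)) / (2 * \<i>))"
      by (auto simp: fun_eq_iff complex_diff_cnj mult_ac simp flip: left_diff_distrib)
    then show ?thesis using *[of t] cnj[of t] iz[OF Z, of t] iz[of "\<lambda>\<omega>. cnj (Z \<omega>)" t] Z by simp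
  qed
  have 1: "(LINT \<omega>|M. Re (Z \<omega>) * indicator A (X \<omega>)) = 0"
    using Z Re by (intro real_weight_char_zero) auto
  have 2: "(LINT \<omega>|M. Im (Z \<omega>) * indicator A (X \<omega>)) = 0"
    using Z Im by (intro real_weight_char_zero) auto
  have "integrable M (\<lambda>\<omega>. Z \<omega> * indicator A (X \<omega>))"
    using Z by (rule Bochner_Integration.integrable_bound) (auto simp: norm_mult indicator_def)
  then show ?thesis
    using 1 2 by (simp add: complex_eq_iff indicator_def of_bool_def if_distrib cong: if_cong
       flip: integral_Re integral_Im)
qed

text \<open>Replaces the exponentials by indicators one coordinate at a time, because uniqueness of
  characteristic functions is available only in dimension one.\<close>
lemma complex_weight_char_zero_multi:
  fixes Z :: "'a \<Rightarrow> complex" and X :: "'i \<Rightarrow> 'a \<Rightarrow> real"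
  assumes "finite J" and "integrable M Z" and "\<And>j. j \<in> J \<Longrightarrow> X j \<in> borel_measurable M"
    and "\<And>t. (CLINT \<omega>|M. Z \<omega> * iexp (\<Sum>j\<in>J. t j * X j \<omega>)) = 0"
    and "\<And>j. j \<in> J \<Longrightarrow> A j \<in> sets borel"
  shows "(CLINT \<omega>|M. Z \<omega> * (\<Prod>j\<in>J. indicator (A j) (X j \<omega>))) = 0"
  using assms
proof (induction J arbitrary: Z rule: finite_induct)
  case empty
  then show ?case by simp
next
  case (insert i J)
  have [measurable]: "X i \<in> borel_measurable M" "A i \<in> sets borel"
    "Z \<in> borel_measurable M"
    using insert.prems by auto
  have m[measurable]: "X j \<in> borel_measurable M" "A j \<in> sets borel" if "j \<in> J" for j
    using insert.prems that by auto
  have iexpi: "integrable M (\<lambda>\<omega>. Z \<omega> * iexp (s * X i \<omega>))" for s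
    using \<open>integrable M Z\<close> by (rule Bochner_Integration.integrable_bound) (auto simp: norm_mult)
  \<comment> \<open>One exponential factor joins the weight, and the induction hypothesis turns the
    others into indicators. As \<open>s\<close> is arbitrary, the one-dimensional result then
    applies to coordinate \<open>i\<close>, with the indicators of \<open>J\<close> in the
    weight.\<close>
  have 1: "(CLINT \<omega>|M. Z \<omega> * iexp (s * X i \<omega>) * (\<Prod>j\<in>J. indicator (A j) (X j \<omega>))) = 0" for s
  proof (rule insert.IH[OF iexpi])
    fix t :: "'i \<Rightarrow> real"
    have "(\<Sum>j\<in>insert i J. (t(i := s)) j * X j \<omega>) = s * X i \<omega> + (\<Sum>j\<in>J. t j * X j \<omega>)" for \<omega>
      using insert.hyps by (auto intro!: sum.cong)
    then have "(\<lambda>\<omega>. Z \<omega> * iexp (\<Sum>j\<in>insert i J. (t(i := s)) j * X j \<omega>))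
      = (\<lambda>\<omega>. Z \<omega> * iexp (s * X i \<omega>) * iexp (\<Sum>j\<in>J. t j * X j \<omega>))"
      by (simp add: distrib_left exp_add mult.assoc)
    then show "(CLINT \<omega>|M. Z \<omega> * iexp (s * X i \<omega>) * iexp (\<Sum>j\<in>J. t j * X j \<omega>)) = 0"
      using insert.prems(3)[of "t(i := s)"] by simp
  qed (use m in auto)
  have [measurable]: "(\<lambda>\<omega>. (\<Prod>j\<in>J. indicator (A j) (X j \<omega>)) :: complex) \<in> borel_measurable M"
    by (intro borel_measurable_prod) measurable
  have "integrable M (\<lambda>\<omega>. Z \<omega> * (\<Prod>j\<in>J. indicator (A j) (X j \<omega>)))"
    using \<open>integrable M Z\<close>
    by (rule Bochner_Integration.integrable_bound)
       (auto simp: norm_mult prod_norm[symmetric] indicator_def intro!: mult_left_le prod_le_1)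
  then have "(CLINT \<omega>|M. (Z \<omega> * (\<Prod>j\<in>J. indicator (A j) (X j \<omega>))) * indicator (A i) (X i \<omega>)) = 0"
    by (rule complex_weight_char_zero) (use 1 in \<open>auto simp: mult_ac\<close>)
  then show ?case using insert.hyps by (simp add: mult_ac)
qed

section \<open>The sigma-algebra generated by a family\<close>

lemma space_gen_sigma[simp]: "space (gen_sigma M J X) = space M"
  unfolding gen_sigma_def by (rule space_measure_of) auto

lemma sets_gen_sigma: "sets (gen_sigma M J X) = sigma_sets (space M) {X i -` A \<inter> space M | i A. i \<in> J \<and> A \<in> sets borel}"
  unfolding gen_sigma_def by (rule sets_measure_of) auto

lemma subalgebra_gen_sigma:
  assumes "\<And>j. j \<in> J \<Longrightarrow> X j \<in> borel_measurable M"
  shows "subalgebra M (gen_sigma M J X)"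
  unfolding subalgebra_def sets_gen_sigma using assms
  by (auto intro!: sets.sigma_sets_subset)

lemma measurable_gen_sigma:
  assumes "j \<in> J" shows "X j \<in> borel_measurable (gen_sigma M J X)"
  by (rule measurableI) (use assms in \<open>auto simp: sets_gen_sigma\<close>)

text \<open>Dynkin's argument: boxes are stable under intersection and generate the sigma-algebra,
  the integral of \<open>Z\<close> vanishes on each of them, and this property passes to complements
  and countable disjoint unions.\<close>

lemma real_weight_zero_gen_sigma:
  fixes Z :: "'a \<Rightarrow> real" and X :: "'i \<Rightarrow> 'a \<Rightarrow> real"
  assumes J: "finite J" and Z: "integrable M Z" and X: "\<And>j. j \<in> J \<Longrightarrow> X j \<in> borel_measurable M"
    and *: "\<And>t. (CLINT \<omega>|M. Z \<omega> * iexp (\<Sum>j\<in>J. t j * X j \<omega>)) = 0"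
    and F: "F \<in> sets (gen_sigma M J X)"
  shows "(LINT \<omega>:F|M. Z \<omega>) = 0"
proof -
  define box where "box A = {\<omega>\<in>space M. \<forall>j\<in>J. X j \<omega> \<in> A j}" for A :: "'i \<Rightarrow> real set"
  define G where "G = box ` {A. \<forall>j. A j \<in> sets borel}"
  have boxM: "box A \<in> sets M" if "\<And>j. A j \<in> sets borel" for A
    unfolding box_def using X that J by measurable
  have b0: "(LINT \<omega>:box A|M. Z \<omega>) = 0" if "\<And>j. A j \<in> sets borel" for A
  proof -
    have "(CLINT \<omega>|M. complex_of_real (Z \<omega>) * (\<Prod>j\<in>J. indicator (A j) (X j \<omega>))) = 0"
      by (rule complex_weight_char_zero_multi) (use assms that in auto)
    also have "(CLINT \<omega>|M. complex_of_real (Z \<omega>) * (\<Prod>j\<in>J. indicator (A j) (X j \<omega>)))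
       = (CLINT \<omega>|M. complex_of_real (indicator (box A) \<omega> * Z \<omega>))"
      by (intro Bochner_Integration.integral_cong refl)
         (use J in \<open>auto simp: box_def indicator_def prod_zero_iff\<close>)
    finally show ?thesis unfolding integral_complex_of_real by (simp add: set_lebesgue_integral_def)
  qed
  have G: "Int_stable G" "G \<subseteq> Pow (space M)"
  proof -
    have "box A \<inter> box B = box (\<lambda>j. A j \<inter> B j)" for A B by (auto simp: box_def)
    then show "Int_stable G" unfolding Int_stable_def G_def by (auto intro!: image_eqI)
    show "G \<subseteq> Pow (space M)" by (auto simp: G_def box_def)
  qed
  have GM: "sigma_sets (space M) G \<subseteq> sets M"
    by (rule sets.sigma_sets_subset) (auto simp: G_def boxM)
  \<comment> \<open>The whole space is a box with all sides \<open>UNIV\<close>; its zero integral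
    is what the complement case needs.\<close>
  have space: "(LINT \<omega>:space M|M. Z \<omega>) = 0"
    using b0[of "\<lambda>_. UNIV"] by (simp add: box_def)
  have "{X i -` A \<inter> space M | i A. i \<in> J \<and> A \<in> sets borel} \<subseteq> G"
  proof safe
    fix i and A :: "real set" assume "i \<in> J" "A \<in> sets borel"
    then show "X i -` A \<inter> space M \<in> G"
      unfolding G_def by (intro image_eqI[of _ _ "\<lambda>j. if j = i then A else UNIV"]) (auto simp: box_def)
  qed
  then have "F \<in> sigma_sets (space M) G"
    using F unfolding sets_gen_sigma by (blast dest: sigma_sets_mono')
  with G show ?thesis
  proof (induction F rule: sigma_sets_induct_disjoint)
    case (basic A)
    then show ?case by (auto simp: G_def b0)
  next
    case empty
    show ?case by (simp add: set_lebesgue_integral_def)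
  next
    case (compl A)
    have [measurable]: "A \<in> sets M" using compl GM by auto
    have "(LINT \<omega>:space M|M. Z \<omega>) = (LINT \<omega>:(space M - A) \<union> A|M. Z \<omega>)"
      using sets.sets_into_space[OF \<open>A \<in> sets M\<close>] by (simp add: Un_absorb2)
    also have "\<dots> = (LINT \<omega>:space M - A|M. Z \<omega>) + (LINT \<omega>:A|M. Z \<omega>)"
      using Z by (intro set_integral_Un) (auto simp: set_integrable_def intro!: integrable_mult_indicator[where 'b=real, simplified])
    finally show ?case using compl space by simp
  next
    case (union A)
    have "A i \<in> sets M" for i using union GM by auto
    moreover from this have "set_integrable M (\<Union>i. A i) Z"
      using Z unfolding set_integrable_def by (intro integrable_mult_indicator) auto
    ultimately have "(LINT x:(\<Union>i. A i)|M. Z x) = (\<Sum>i. (LINT x:(A i)|M. Z x))"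
      using union by (intro lebesgue_integral_countable_add) (auto simp: disjoint_family_on_def)
    then show ?case using union by simp
  qed
qed

section \<open>Second moments, uncorrelated Gaussian variables and linear projection\<close>

lemma integrable_mult_of_squares:
  fixes X Y :: "'a \<Rightarrow> real"
  assumes "X \<in> borel_measurable M" "Y \<in> borel_measurable M"
    "integrable M (\<lambda>\<omega>. (X \<omega>)\<^sup>2)" "integrable M (\<lambda>\<omega>. (Y \<omega>)\<^sup>2)"
  shows "integrable M (\<lambda>\<omega>. X \<omega> * Y \<omega>)"
proof (rule Bochner_Integration.integrable_bound[OF Bochner_Integration.integrable_add[OF assms(3,4)]])
  show "AE \<omega> in M. norm (X \<omega> * Y \<omega>) \<le> norm ((X \<omega>)\<^sup>2 + (Y \<omega>)\<^sup>2)"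
  proof (rule AE_I2)
    fix \<omega>
    have "2 * \<bar>X \<omega>\<bar> * \<bar>Y \<omega>\<bar> \<le> \<bar>X \<omega>\<bar>\<^sup>2 + \<bar>Y \<omega>\<bar>\<^sup>2" by (rule sum_squares_bound)
    then show "norm (X \<omega> * Y \<omega>) \<le> norm ((X \<omega>)\<^sup>2 + (Y \<omega>)\<^sup>2)"
      unfolding real_norm_def abs_mult power2_abs mult.assoc
      by (smt (verit) mult_nonneg_nonneg abs_ge_zero)
  qed
qed (use assms in measurable)

text \<open>Serves in place of independence of uncorrelated jointly Gaussian variables. Without
  correlation the variance of \<open>s * e + Y\<close> has no term linear in \<open>s\<close>, so
  its characteristic function at 1 has derivative 0 in \<open>s\<close> at 0; differentiating under
  the expectation gives \<open>\<i>\<close> times the claimed integral.\<close>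

lemma gaussian_uncorrelated_iexp:
  fixes e Y :: "'a \<Rightarrow> real"
  assumes "prob_space M" and g: "\<And>s. centered_gaussian_rv M (\<lambda>\<omega>. s * e \<omega> + Y \<omega>)"
    and e: "centered_gaussian_rv M e" and 0: "(LINT \<omega>|M. e \<omega> * Y \<omega>) = 0"
  shows "(CLINT \<omega>|M. e \<omega> * iexp (Y \<omega>)) = 0"
proof -
  interpret prob_space M by fact
  have Y: "centered_gaussian_rv M Y" using g[of 0] by simp
  note me = gaussian_moments[OF assms(1) e] and mY = gaussian_moments[OF assms(1) Y]
  note [measurable] = me(1) mY(1)
  define v w where "v = (LINT \<omega>|M. (e \<omega>)\<^sup>2)" and "w = (LINT \<omega>|M. (Y \<omega>)\<^sup>2)"
  have "(LINT \<omega>|M. (s * e \<omega> + Y \<omega>)\<^sup>2) = s\<^sup>2 * v + w" for s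
  proof -
    have "(\<lambda>\<omega>. (s * e \<omega> + Y \<omega>)\<^sup>2) = (\<lambda>\<omega>. s\<^sup>2 * (e \<omega>)\<^sup>2 + 2 * s * (e \<omega> * Y \<omega>) + (Y \<omega>)\<^sup>2)"
      by (auto simp: power2_eq_square algebra_simps)
    then show ?thesis
      using me mY 0 integrable_mult_of_squares[OF me(1) mY(1) me(2) mY(2)] by (simp add: v_def w_def)
  qed
  then have ch: "(CLINT \<omega>|M. iexp (s * e \<omega> + Y \<omega>)) = complex_of_real (exp (- (s\<^sup>2 * v + w) / 2))" for s
    using gaussian_moments(5)[OF assms(1) g[of s]] by simp
  define h where "h n = 1 / real (Suc n)" for n
  have h: "h n > 0" for n by (simp add: h_def)
  have h0: "filterlim h (at 0) sequentially"
    unfolding filterlim_at using LIMSEQ_inverse_real_of_nat h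
    by (auto simp: h_def[abs_def] inverse_eq_divide less_imp_neq[symmetric] simp del: of_nat_Suc intro!: always_eventually)
  have ii: "integrable M (\<lambda>\<omega>. iexp (s * e \<omega> + Y \<omega>))" for s
    by (intro integrable_const_bound[of _ 1]) auto
  \<comment> \<open>differentiate \<open>E exp(i(s e + Y)) = E exp(i s e) E exp(i Y)\<close> at \<open>s = 0\<close>\<close>
  have "(\<lambda>n. CLINT \<omega>|M. (iexp (h n * e \<omega> + Y \<omega>) - iexp (Y \<omega>)) / h n) \<longlonglongrightarrow> (CLINT \<omega>|M. (\<i> * e \<omega>) * iexp (Y \<omega>))"
  \<comment> \<open>The difference quotients are dominated by the modulus of \<open>e\<close>,
    because \<open>iexp x - 1\<close> has modulus at most that of \<open>x\<close>.\<close>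
  proof (rule integral_dominated_convergence[where w="\<lambda>\<omega>. \<bar>e \<omega>\<bar>"])
    show "integrable M (\<lambda>\<omega>. \<bar>e \<omega>\<bar>)" using me by auto
    show "AE \<omega> in M. cmod ((iexp (h n * e \<omega> + Y \<omega>) - iexp (Y \<omega>)) / h n) \<le> \<bar>e \<omega>\<bar>" for n
    proof (rule AE_I2)
      fix \<omega>
      have "iexp (h n * e \<omega> + Y \<omega>) - iexp (Y \<omega>) = (iexp (h n * e \<omega>) - 1) * iexp (Y \<omega>)"
        by (simp add: distrib_left exp_add algebra_simps)
      then have "cmod ((iexp (h n * e \<omega> + Y \<omega>) - iexp (Y \<omega>)) / h n) = cmod (iexp (h n * e \<omega>) - 1) / h n"
        using h[of n] by (simp add: norm_mult norm_divide)
      also have "\<dots> \<le> \<bar>h n * e \<omega>\<bar> / h n"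
        using iexp_approx1[of "h n * e \<omega>" 0] h[of n] by (intro divide_right_mono) auto
      also have "\<dots> = \<bar>e \<omega>\<bar>" using h[of n] by (simp add: abs_mult)
      finally show "cmod ((iexp (h n * e \<omega> + Y \<omega>) - iexp (Y \<omega>)) / h n) \<le> \<bar>e \<omega>\<bar>" .
    qed
    show "AE \<omega> in M. (\<lambda>n. (iexp (h n * e \<omega> + Y \<omega>) - iexp (Y \<omega>)) / h n) \<longlonglongrightarrow> (\<i> * e \<omega>) * iexp (Y \<omega>)"
    proof (rule AE_I2)
      fix \<omega>
      have "((\<lambda>z::complex. exp (\<i> * (z * e \<omega> + Y \<omega>))) has_field_derivative ((\<i> * e \<omega>) * iexp (Y \<omega>))) (at 0)"
        by (auto intro!: derivative_eq_intros)
      then have "((\<lambda>z::complex. (exp (\<i> * (z * e \<omega> + Y \<omega>)) - iexp (Y \<omega>)) / z) \<longlongrightarrow> (\<i> * e \<omega>) * iexp (Y \<omega>)) (at 0)"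
        by (simp add: has_field_derivative_iff)
      moreover have "filterlim (\<lambda>n. complex_of_real (h n)) (at 0) sequentially"
        using h0 tendsto_of_real[of h 0 sequentially] unfolding filterlim_at by simp
      ultimately show "(\<lambda>n. (iexp (h n * e \<omega> + Y \<omega>) - iexp (Y \<omega>)) / h n) \<longlonglongrightarrow> (\<i> * e \<omega>) * iexp (Y \<omega>)"
        using filterlim_compose by fastforce
    qed
  qed auto
  moreover have "(\<lambda>n. CLINT \<omega>|M. (iexp (h n * e \<omega> + Y \<omega>) - iexp (Y \<omega>)) / h n)
    = (\<lambda>n. complex_of_real ((exp (- ((h n)\<^sup>2 * v + w) / 2) - exp (- w / 2)) / h n))"
    using ch ch[of 0] ii ii[of 0] by simp
  moreover have "(\<lambda>n. complex_of_real ((exp (- ((h n)\<^sup>2 * v + w) / 2) - exp (- w / 2)) / h n)) \<longlonglongrightarrow> complex_of_real 0"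
  proof (intro tendsto_of_real)
    have "((\<lambda>s. exp (- (s\<^sup>2 * v + w) / 2)) has_real_derivative 0) (at 0)"
      by (auto intro!: derivative_eq_intros)
    then have "((\<lambda>s. (exp (- (s\<^sup>2 * v + w) / 2) - exp (- w / 2)) / s) \<longlongrightarrow> 0) (at 0)"
      by (simp add: has_field_derivative_iff)
    from filterlim_compose[OF this h0]
    show "(\<lambda>n. (exp (- ((h n)\<^sup>2 * v + w) / 2) - exp (- w / 2)) / h n) \<longlonglongrightarrow> 0" .
  qed
  ultimately have "(CLINT \<omega>|M. (\<i> * e \<omega>) * iexp (Y \<omega>)) = 0"
    using LIMSEQ_unique by fastforce
  then show ?thesis by (simp add: mult.assoc)
qed

definition square_integrable :: "'a measure \<Rightarrow> ('a \<Rightarrow> real) \<Rightarrow> bool" where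
  "square_integrable M X \<longleftrightarrow> X \<in> borel_measurable M \<and> integrable M (\<lambda>\<omega>. (X \<omega>)\<^sup>2)"

lemma square_integrable_mult:
  "square_integrable M X \<Longrightarrow> square_integrable M Y \<Longrightarrow> integrable M (\<lambda>\<omega>. X \<omega> * Y \<omega>)"
  unfolding square_integrable_def by (blast intro: integrable_mult_of_squares)

lemma square_integrable_add:
  assumes "square_integrable M X" "square_integrable M Y"
  shows "square_integrable M (\<lambda>\<omega>. X \<omega> + Y \<omega>)"
proof -
  have "(\<lambda>\<omega>. (X \<omega> + Y \<omega>)\<^sup>2) = (\<lambda>\<omega>. (X \<omega>)\<^sup>2 + 2 * (X \<omega> * Y \<omega>) + (Y \<omega>)\<^sup>2)"
    by (auto simp: power2_eq_square algebra_simps)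
  then show ?thesis
    using assms square_integrable_mult[OF assms] unfolding square_integrable_def by auto
qed

lemma square_integrable_cmult:
  "square_integrable M X \<Longrightarrow> square_integrable M (\<lambda>\<omega>. c * X \<omega>)"
  unfolding square_integrable_def by (auto simp: power_mult_distrib)

lemma square_integrable_diff:
  assumes "square_integrable M X" "square_integrable M Y"
  shows "square_integrable M (\<lambda>\<omega>. X \<omega> - Y \<omega>)"
  using square_integrable_add[OF assms(1) square_integrable_cmult[OF assms(2), of "-1"]] by simp

lemma square_integrable_sum:
  assumes "\<And>j. j \<in> J \<Longrightarrow> square_integrable M (X j)"
  shows "square_integrable M (\<lambda>\<omega>. \<Sum>j\<in>J. X j \<omega>)"
  using assms
proof (induction J rule: infinite_finite_induct)
  case (insert j J)
  then show ?case using square_integrable_add[of M "X j"] by simp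
qed (auto simp: square_integrable_def)

lemmas square_integrable_intros =
  square_integrable_add square_integrable_diff square_integrable_cmult square_integrable_sum

text \<open>Gram-Schmidt by induction: \<open>u\<close> and \<open>w\<close> are the residuals of
  \<open>X i\<close> and \<open>Y\<close> after projection on \<open>J\<close>, and \<open>w\<close>
  is then projected on \<open>u\<close>. The Gram matrix may be singular.\<close>

lemma linear_projection_exists:
  fixes X :: "'i \<Rightarrow> 'a \<Rightarrow> real"
  assumes "finite J" and "\<And>j. j \<in> J \<Longrightarrow> square_integrable M (X j)" and "square_integrable M Y"
  shows "\<exists>c. \<forall>j\<in>J. (LINT \<omega>|M. (Y \<omega> - (\<Sum>i\<in>J. c i * X i \<omega>)) * X j \<omega>) = 0"
  using assms
proof (induction J arbitrary: Y rule: finite_induct)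
  case empty
  then show ?case by simp
next
  case (insert i J)
  have X: "square_integrable M (X j)" if "j \<in> insert i J" for j using insert.prems that by auto
  obtain c where c: "\<And>j. j \<in> J \<Longrightarrow> (LINT \<omega>|M. (X i \<omega> - (\<Sum>i\<in>J. c i * X i \<omega>)) * X j \<omega>) = 0"
    using insert.IH[of "X i"] X by auto
  obtain d where d: "\<And>j. j \<in> J \<Longrightarrow> (LINT \<omega>|M. (Y \<omega> - (\<Sum>i\<in>J. d i * X i \<omega>)) * X j \<omega>) = 0"
    using insert.IH[of Y] X insert.prems by auto
  define u where "u = (\<lambda>\<omega>. X i \<omega> - (\<Sum>i\<in>J. c i * X i \<omega>))"
  define w where "w = (\<lambda>\<omega>. Y \<omega> - (\<Sum>i\<in>J. d i * X i \<omega>))"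
  have sq: "square_integrable M u" "square_integrable M w"
    unfolding u_def w_def using X insert.prems by (auto intro!: square_integrable_intros)
  define k where "k = (LINT \<omega>|M. w \<omega> * u \<omega>) / (LINT \<omega>|M. u \<omega> * u \<omega>)"
  \<comment> \<open>If \<open>u\<close> has norm zero it vanishes almost everywhere, so both terms
    are 0 whatever \<open>k\<close> is.\<close>
  have k: "(LINT \<omega>|M. w \<omega> * u \<omega>) - k * (LINT \<omega>|M. u \<omega> * u \<omega>) = 0"
  proof (cases "(LINT \<omega>|M. u \<omega> * u \<omega>) = 0")
    case True
    then have "AE \<omega> in M. u \<omega> * u \<omega> = 0"
      using square_integrable_mult[OF sq(1) sq(1)] by (subst (asm) integral_nonneg_eq_0_iff_AE) auto
    then have "AE \<omega> in M. w \<omega> * u \<omega> = 0" by eventually_elim auto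
    then show ?thesis using True by (simp add: integral_eq_zero_AE)
  qed (simp add: k_def)
  define b where "b = (\<lambda>j. if j = i then k else d j - k * c j)"
  have r: "Y \<omega> - (\<Sum>j\<in>insert i J. b j * X j \<omega>) = w \<omega> - k * u \<omega>" for \<omega>
  proof -
    have "(\<Sum>j\<in>J. b j * X j \<omega>) = (\<Sum>j\<in>J. d j * X j \<omega>) - k * (\<Sum>j\<in>J. c j * X j \<omega>)"
      unfolding sum_distrib_left sum_subtractf[symmetric]
      by (intro sum.cong) (use insert.hyps in \<open>auto simp: b_def algebra_simps\<close>)
    then show ?thesis
      using insert.hyps by (simp add: b_def u_def w_def algebra_simps)
  qed
  have wu: "(LINT \<omega>|M. (w \<omega> - k * u \<omega>) * Z \<omega>) = (LINT \<omega>|M. w \<omega> * Z \<omega>) - k * (LINT \<omega>|M. u \<omega> * Z \<omega>)"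
    if "square_integrable M Z" for Z
    using square_integrable_mult[OF sq(1) that] square_integrable_mult[OF sq(2) that]
    by (simp add: left_diff_distrib mult.assoc)
  have j0: "(LINT \<omega>|M. (w \<omega> - k * u \<omega>) * X j \<omega>) = 0" if "j \<in> J" for j
    using wu[of "X j"] X[of j] c[OF that] d[OF that] that by (simp add: u_def w_def)
  \<comment> \<open>Since \<open>X i\<close> is \<open>u\<close> plus a combination of the earlier
    variables, orthogonality to \<open>u\<close> and to those variables suffices.\<close>
  have "(LINT \<omega>|M. (w \<omega> - k * u \<omega>) * X i \<omega>) = (LINT \<omega>|M. (w \<omega> - k * u \<omega>) * u \<omega> + (\<Sum>j\<in>J. c j * ((w \<omega> - k * u \<omega>) * X j \<omega>)))"
  proof (intro Bochner_Integration.integral_cong refl)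
    fix \<omega>
    have xi: "X i \<omega> = u \<omega> + (\<Sum>j\<in>J. c j * X j \<omega>)" by (simp add: u_def)
    show "(w \<omega> - k * u \<omega>) * X i \<omega> = (w \<omega> - k * u \<omega>) * u \<omega> + (\<Sum>j\<in>J. c j * ((w \<omega> - k * u \<omega>) * X j \<omega>))"
      by (subst xi) (simp add: distrib_left sum_distrib_left mult.left_commute)
  qed
  also have "\<dots> = 0"
  proof -
    have s: "square_integrable M (\<lambda>\<omega>. w \<omega> - k * u \<omega>)" by (intro square_integrable_intros sq)
    show ?thesis
      using square_integrable_mult[OF s] X sq wu[OF sq(1)] k j0 by (simp add: integral_sum)
  qed
  finally have "\<forall>j\<in>insert i J. (LINT \<omega>|M. (Y \<omega> - (\<Sum>i\<in>insert i J. b i * X i \<omega>)) * X j \<omega>) = 0"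
    unfolding r using j0 by auto
  then show ?case by blast
qed

section \<open>Conditional variance as least mean square prediction error\<close>

definition gaussian_family :: "'a measure \<Rightarrow> (nat \<Rightarrow> 'a \<Rightarrow> real) \<Rightarrow> bool" where
  "gaussian_family M X \<longleftrightarrow> (\<forall>n c. centered_gaussian_rv M (\<lambda>\<omega>. \<Sum>j<n. c j * X j \<omega>))"

lemma gaussian_family_finite_sum:
  assumes "gaussian_family M X" "finite J"
  shows "centered_gaussian_rv M (\<lambda>\<omega>. \<Sum>j\<in>J. c j * X j \<omega>)"
proof -
  obtain n where n: "J \<subseteq> {..<n}" using assms(2) finite_nat_iff_bounded by blast
  have "(\<Sum>j<n. (if j \<in> J then c j else 0) * X j \<omega>) = (\<Sum>j\<in>J. c j * X j \<omega>)" for \<omega>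
    using n by (intro sum.mono_neutral_cong_right) auto
  moreover have "centered_gaussian_rv M (\<lambda>\<omega>. \<Sum>j<n. (if j \<in> J then c j else 0) * X j \<omega>)"
    by (rule assms(1)[unfolded gaussian_family_def, rule_format])
  ultimately show ?thesis by simp
qed

text \<open>The residual \<open>e\<close> of the linear projection integrates to 0 over every event
  of the generated sigma-algebra, so the projection is the conditional expectation. Being almost
  surely constant, the conditional variance equals its mean, the second moment of \<open>e\<close>;
  Pythagoras then compares it with any other predictor.\<close>

lemma gaussian_cond_var:
  assumes M: "prob_space M" and X: "gaussian_family M X" and J: "finite J" "k \<notin> J"
    and r: "AE \<omega> in M. cond_var M (gen_sigma M J X) (X k) \<omega> = r"
  shows "\<exists>c. r = (LINT \<omega>|M. (X k \<omega> - (\<Sum>j\<in>J. c j * X j \<omega>))\<^sup>2)"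
    "r \<le> (LINT \<omega>|M. (X k \<omega> - (\<Sum>j\<in>J. b j * X j \<omega>))\<^sup>2)"
proof -
  interpret prob_space M by fact
  have g1: "centered_gaussian_rv M (X j)" for j
    using gaussian_family_finite_sum[OF X, of "{j}" "\<lambda>_. 1"] by simp
  note m = gaussian_moments[OF M]
  have sq: "square_integrable M (X j)" for j
    using m(1,2)[OF g1] by (simp add: square_integrable_def)
  have [measurable]: "X j \<in> borel_measurable M" for j using m(1)[OF g1] .
  obtain c where c: "\<forall>j\<in>J. (LINT \<omega>|M. (X k \<omega> - (\<Sum>i\<in>J. c i * X i \<omega>)) * X j \<omega>) = 0"
    using linear_projection_exists[of J M X "X k", OF J(1) sq sq] by (rule exE)
  define e where "e = (\<lambda>\<omega>. X k \<omega> - (\<Sum>i\<in>J. c i * X i \<omega>))"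
  define P where "P = (\<lambda>\<omega>. \<Sum>i\<in>J. c i * X i \<omega>)"
  have sqe: "square_integrable M e" unfolding e_def by (intro square_integrable_intros sq)
  have orth: "(LINT \<omega>|M. e \<omega> * (\<Sum>j\<in>J. t j * X j \<omega>)) = 0" for t
  proof -
    have "(LINT \<omega>|M. e \<omega> * (\<Sum>j\<in>J. t j * X j \<omega>)) = (LINT \<omega>|M. (\<Sum>j\<in>J. t j * (e \<omega> * X j \<omega>)))"
      by (simp add: sum_distrib_left mult_ac)
    also have "\<dots> = 0"
      using c square_integrable_mult[OF sqe sq] by (simp add: e_def integral_sum)
    finally show ?thesis .
  qed
  have lin: "centered_gaussian_rv M (\<lambda>\<omega>. s * e \<omega> + (\<Sum>j\<in>J. t j * X j \<omega>))" for s t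
  proof -
    have "(\<Sum>j\<in>insert k J. (if j = k then s else t j - s * c j) * X j \<omega>) = s * e \<omega> + (\<Sum>j\<in>J. t j * X j \<omega>)" for \<omega>
    proof -
      have "(\<Sum>j\<in>J. (if j = k then s else t j - s * c j) * X j \<omega>) = (\<Sum>j\<in>J. t j * X j \<omega>) - s * (\<Sum>j\<in>J. c j * X j \<omega>)"
        unfolding sum_distrib_left sum_subtractf[symmetric]
        by (intro sum.cong) (use J in \<open>auto simp: algebra_simps\<close>)
      then show ?thesis using J by (simp add: e_def algebra_simps)
    qed
    then show ?thesis using gaussian_family_finite_sum[OF X, of "insert k J" "\<lambda>j. if j = k then s else t j - s * c j"] J by simp
  qed
  have ge: "centered_gaussian_rv M e" using lin[of 1 "\<lambda>_. 0"] by simp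
  have wt: "(CLINT \<omega>|M. e \<omega> * iexp (\<Sum>j\<in>J. t j * X j \<omega>)) = 0" for t
    by (intro gaussian_uncorrelated_iexp M lin ge orth)
  let ?F = "gen_sigma M J X"
  interpret finite_measure_subalgebra M ?F
    by unfold_locales (rule subalgebra_gen_sigma, simp)
  have iP: "integrable M P" unfolding P_def using m(3)[OF gaussian_family_finite_sum[OF X J(1)]] .
  have "AE \<omega> in M. real_cond_exp M ?F (X k) \<omega> = P \<omega>"
  proof (rule real_cond_exp_charact)
    fix A assume A: "A \<in> sets ?F"
    have [measurable]: "A \<in> sets M" using A subalg unfolding subalgebra_def by auto
    have "(LINT \<omega>:A|M. e \<omega>) = 0"
      using real_weight_zero_gen_sigma[OF J(1) _ _ wt A] m(3)[OF ge] by simp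
    moreover have "(LINT \<omega>:A|M. e \<omega>) = (LINT \<omega>:A|M. X k \<omega>) - (LINT \<omega>:A|M. P \<omega>)"
      unfolding e_def P_def[symmetric, THEN fun_cong, simplified]
      by (intro set_integral_diff)
         (auto simp: set_integrable_def intro!: integrable_mult_indicator[where 'b=real, simplified] m(3)[OF g1] iP)
    ultimately show "(LINT \<omega>:A|M. X k \<omega>) = (LINT \<omega>:A|M. P \<omega>)" by simp
  next
    show "P \<in> borel_measurable ?F"
      unfolding P_def using measurable_gen_sigma[of _ J X M] by measurable
  qed (use iP m(3)[OF g1] in auto)
  then have AE: "AE \<omega> in M. (X k \<omega> - real_cond_exp M ?F (X k) \<omega>)\<^sup>2 = (e \<omega>)\<^sup>2"
    by eventually_elim (simp add: e_def P_def)
  have [measurable]: "real_cond_exp M ?F (X k) \<in> borel_measurable M" by simp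
  have ie2: "integrable M (\<lambda>\<omega>. (e \<omega>)\<^sup>2)" and [measurable]: "e \<in> borel_measurable M"
    using sqe by (auto simp: square_integrable_def)
  have i2: "integrable M (\<lambda>\<omega>. (X k \<omega> - real_cond_exp M ?F (X k) \<omega>)\<^sup>2)"
    using ie2 AE by (subst integrable_cong_AE[where g="\<lambda>\<omega>. (e \<omega>)\<^sup>2"]) auto
  have "r = (LINT \<omega>|M. cond_var M ?F (X k) \<omega>)"
    using r by (subst integral_cong_AE[where g="\<lambda>_. r"]) (auto simp: prob_space cond_var_def)
  also have "\<dots> = (LINT \<omega>|M. (X k \<omega> - real_cond_exp M ?F (X k) \<omega>)\<^sup>2)"
    unfolding cond_var_def by (rule real_cond_exp_int(2)[OF i2])
  also have "\<dots> = (LINT \<omega>|M. (e \<omega>)\<^sup>2)"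
    using AE by (intro integral_cong_AE) auto
  finally have re: "r = (LINT \<omega>|M. (e \<omega>)\<^sup>2)" .
  then show "\<exists>c. r = (LINT \<omega>|M. (X k \<omega> - (\<Sum>j\<in>J. c j * X j \<omega>))\<^sup>2)" unfolding e_def by blast
  \<comment> \<open>The other prediction error is \<open>e + D\<close>, where \<open>D\<close> lies
    in the span of the observations and is therefore orthogonal to \<open>e\<close>.\<close>
  define D where "D = (\<lambda>\<omega>. \<Sum>j\<in>J. (c j - b j) * X j \<omega>)"
  have D: "square_integrable M D" unfolding D_def by (intro square_integrable_intros sq)
  have "(\<lambda>\<omega>. (X k \<omega> - (\<Sum>j\<in>J. b j * X j \<omega>))\<^sup>2) = (\<lambda>\<omega>. (e \<omega>)\<^sup>2 + 2 * (e \<omega> * D \<omega>) + (D \<omega>)\<^sup>2)"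
    by (auto simp: D_def e_def left_diff_distrib sum_subtractf power2_eq_square algebra_simps)
  then have "(LINT \<omega>|M. (X k \<omega> - (\<Sum>j\<in>J. b j * X j \<omega>))\<^sup>2) = r + (LINT \<omega>|M. (D \<omega>)\<^sup>2)"
    using ie2 D square_integrable_mult[OF sqe D] orth[of "\<lambda>j. c j - b j"] re
    by (simp add: square_integrable_def D_def)
  moreover have "0 \<le> (LINT \<omega>|M. (D \<omega>)\<^sup>2)" by simp
  ultimately show "r \<le> (LINT \<omega>|M. (X k \<omega> - (\<Sum>j\<in>J. b j * X j \<omega>))\<^sup>2)" by simp
qed

section \<open>Fractional Gaussian noise\<close>

text \<open>Only the difference of the indices enters, so stationarity can be read off by
  unfolding.\<close>

definition fgn_cov :: "real \<Rightarrow> nat \<Rightarrow> nat \<Rightarrow> real" where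
  "fgn_cov H i j = (\<bar>real i - real j + 1\<bar> powr (2*H) + \<bar>real i - real j - 1\<bar> powr (2*H)
     - 2 * \<bar>real i - real j\<bar> powr (2*H)) / 2"

lemma fBm_fGn_gaussian:
  assumes "fBm M H B"
  shows "gaussian_family M (fGn B)"
  unfolding gaussian_family_def
proof (intro allI)
  fix n :: nat and c :: "nat \<Rightarrow> real"
  \<comment> \<open>The two values of \<open>B\<close> in each increment are interleaved: position
    \<open>2*i\<close> carries \<open>c i\<close> at time \<open>i\<close>, position
    \<open>2*i+1\<close> carries \<open>- c i\<close> at time \<open>i - 1\<close>.\<close>
  define d where "d j = (if even j then c (j div 2) else - c (j div 2))" for j
  define t where "t j = (if even j then real (j div 2) else real (j div 2) - 1)" for j
  have "(\<Sum>j<2*n. d j * B (t j) \<omega>) = (\<Sum>j<n. c j * fGn B j \<omega>)" for \<omega>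
    by (induction n) (auto simp: d_def t_def fGn_def algebra_simps)
  moreover have "centered_gaussian_rv M (\<lambda>\<omega>. \<Sum>j<2*n. d j * B (t j) \<omega>)"
    by (rule assms[unfolded fBm_def, THEN conjunct1, rule_format])
  ultimately show "centered_gaussian_rv M (\<lambda>\<omega>. \<Sum>j<n. c j * fGn B j \<omega>)" by simp
qed

lemma fGn_square_integrable:
  assumes "prob_space M" "fBm M H B"
  shows "square_integrable M (fGn B j)" "square_integrable M (B t)"
proof -
  have "centered_gaussian_rv M (\<lambda>\<omega>. \<Sum>j<Suc 0. 1 * B t \<omega>)" for t
    by (rule assms(2)[unfolded fBm_def, THEN conjunct1, rule_format])
  then have "centered_gaussian_rv M (B t)" for t by simp
  then show B: "square_integrable M (B t)" for t
    using gaussian_moments(1,2)[OF assms(1)] by (simp add: square_integrable_def)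
  show "square_integrable M (fGn B j)" unfolding fGn_def by (intro square_integrable_intros B)
qed

lemma fGn_cov:
  assumes "prob_space M" "fBm M H B"
  shows "(LINT \<omega>|M. fGn B i \<omega> * fGn B j \<omega>) = fgn_cov H i j"
proof -
  note i = square_integrable_mult[OF fGn_square_integrable(2)[OF assms] fGn_square_integrable(2)[OF assms]]
  have c: "(LINT \<omega>|M. B t \<omega> * B s \<omega>) = (\<bar>t\<bar> powr (2*H) + \<bar>s\<bar> powr (2*H) - \<bar>t - s\<bar> powr (2*H)) / 2" for s t
    using assms(2) unfolding fBm_def by blast
  have "(LINT \<omega>|M. fGn B i \<omega> * fGn B j \<omega>) = (LINT \<omega>|M. B i \<omega> * B j \<omega> - B i \<omega> * B (real j - 1) \<omega>
      - B (real i - 1) \<omega> * B j \<omega> + B (real i - 1) \<omega> * B (real j - 1) \<omega>)"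
    by (simp add: fGn_def algebra_simps)
  also have "\<dots> = (LINT \<omega>|M. B i \<omega> * B j \<omega>) - (LINT \<omega>|M. B i \<omega> * B (real j - 1) \<omega>)
      - (LINT \<omega>|M. B (real i - 1) \<omega> * B j \<omega>) + (LINT \<omega>|M. B (real i - 1) \<omega> * B (real j - 1) \<omega>)"
    using i by simp
  also have "\<dots> = fgn_cov H i j"
    unfolding c fgn_cov_def by (simp add: field_simps)
  finally show ?thesis .
qed

lemma fGn_quadratic_form:
  assumes "prob_space M" "fBm M H B"
  shows "(LINT \<omega>|M. (\<Sum>j\<in>J. c j * fGn B j \<omega>)\<^sup>2) = (\<Sum>i\<in>J. \<Sum>j\<in>J. c i * c j * fgn_cov H i j)"
proof -
  note i = square_integrable_mult[OF fGn_square_integrable(1)[OF assms] fGn_square_integrable(1)[OF assms]]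
  have "(LINT \<omega>|M. (\<Sum>j\<in>J. c j * fGn B j \<omega>)\<^sup>2) = (LINT \<omega>|M. (\<Sum>i\<in>J. \<Sum>j\<in>J. c i * c j * (fGn B i \<omega> * fGn B j \<omega>)))"
    by (simp add: power2_eq_square sum_product mult_ac)
  also have "\<dots> = (\<Sum>i\<in>J. \<Sum>j\<in>J. c i * c j * (LINT \<omega>|M. fGn B i \<omega> * fGn B j \<omega>))"
    using i by (simp add: integral_sum)
  finally show ?thesis unfolding fGn_cov[OF assms] .
qed

text \<open>Puts the error into the shape of \<open>mvn_quadratic_form_lower_bound\<close>, with
  coefficient 1 on the predicted variable.\<close>

lemma prediction_error:
  fixes G :: "nat \<Rightarrow> 'a \<Rightarrow> real"
  assumes "1 \<le> k"
  shows "G k \<omega> - (\<Sum>j\<in>{1..<k}. b j * G j \<omega>) = (\<Sum>j\<in>{1..k}. (if j = k then 1 else - b j) * G j \<omega>)"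
proof -
  have "{1..k} = insert k {1..<k}" using assms by auto
  then show ?thesis by (simp add: sum_negf)
qed

theorem mainTheorem3:
  fixes M :: "'a measure" and H :: real and B :: "real \<Rightarrow> 'a \<Rightarrow> real" and r :: "nat \<Rightarrow> real"
  assumes "prob_space M"
    and "0 < H" and "H < 1"
    and "fBm M H B"
    and "r 1 = prob_space.variance M (fGn B 1)"
    and "\<And>k. k \<ge> 2 \<Longrightarrow>
           (AE \<omega> in M. cond_var M (gen_sigma M {1..<k} (fGn B)) (fGn B k) \<omega> = r k)"
  shows "\<exists>L. r \<longlonglongrightarrow> L \<and>
           Gamma (3/2 - H) / (Gamma (H + 1/2) * Gamma (2 - 2*H)) \<le> L"
proof -
  let ?G = "fGn B" and ?C = "Gamma (3/2 - H) / (Gamma (H + 1/2) * Gamma (2 - 2*H))"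
  define err where "err k b = (LINT \<omega>|M. (?G k \<omega> - (\<Sum>j\<in>{1..<k}. b j * ?G j \<omega>))\<^sup>2)" for k b
  have attained: "\<exists>c. r k = err k c" and optimal: "r k \<le> err k b" if "2 \<le> k" for k b
    unfolding err_def using gaussian_cond_var[OF assms(1) fBm_fGn_gaussian[OF assms(4)] _ _ assms(6)[OF that]]
    by auto
  have form: "err k b = (\<Sum>i\<in>{1..k}. \<Sum>j\<in>{1..k}. (if i = k then 1 else - b i) * (if j = k then 1 else - b j) * fgn_cov H i j)"
    if "1 \<le> k" for k b
    unfolding err_def prediction_error[OF that] by (rule fGn_quadratic_form[OF assms(1,4)])
  have lower: "?C \<le> err k b" if "1 \<le> k" for k b
  proof -
    let ?c = "\<lambda>j. if j = k then 1 else - b j :: real"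
    \<comment> \<open>Here \<open>a = H - 1/2\<close>, so \<open>2*a+1 = 2*H\<close>, and the
      increments run from \<open>j - 1\<close> to \<open>j\<close>; those with \<open>j < k\<close>
      end at or before \<open>k - 1\<close>.\<close>
    have "1/((2*(H-1/2)+1) * mvn_const (H-1/2)) \<le> (\<Sum>i\<in>{1..k}. \<Sum>j\<in>{1..k}. ?c i * ?c j *
       ((\<bar>real i - (real j - 1)\<bar> powr (2*(H-1/2)+1) + \<bar>(real i - 1) - real j\<bar> powr (2*(H-1/2)+1)
        - \<bar>real i - real j\<bar> powr (2*(H-1/2)+1) - \<bar>(real i - 1) - (real j - 1)\<bar> powr (2*(H-1/2)+1)) / 2))"
      by (rule mvn_quadratic_form_lower_bound[where i=k and t=real and s="\<lambda>i. real i - 1"]) (use assms that in auto)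
    also have "\<dots> = err k b"
      unfolding form[OF that] fgn_cov_def by (intro sum.cong refl arg_cong2[where f="(*)"]) (simp add: algebra_simps)
    finally show ?thesis unfolding mvn_const_eq[OF assms(2,3)] .
  qed
  have dec: "r (Suc k) \<le> r k" if k: "2 \<le> k" for k
  proof -
    obtain c where c: "r k = err k c" using attained[OF k] by blast
    \<comment> \<open>The optimal predictor for \<open>k\<close> is moved one step ahead and ignores
      the first observation; by stationarity its error is unchanged.\<close>
    define b where "b j = (if j = 1 then 0 else c (j - 1))" for j
    have "r (Suc k) \<le> err (Suc k) b" using optimal[of "Suc k"] k by simp
    also have "err (Suc k) b = err k c"
    proof -
      let ?d = "\<lambda>j. if j = Suc k then 1 else - b j" and ?e = "\<lambda>j. if j = k then 1 else - c j"
      have S: "(\<Sum>i\<in>{1..Suc k}. f i) = (\<Sum>i\<in>{1..k}. f (Suc i))" if "f 1 = 0" for f :: "nat \<Rightarrow> real"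
        using sum.atLeast_Suc_atMost[of 1 "Suc k" f] that sum.shift_bounds_cl_Suc_ivl[of f 1 k] by simp
      have d: "?d 1 = 0" "\<And>j. 1 \<le> j \<Longrightarrow> ?d (Suc j) = ?e j" using k by (auto simp: b_def)
      have "err (Suc k) b = (\<Sum>i\<in>{1..Suc k}. \<Sum>j\<in>{1..Suc k}. ?d i * ?d j * fgn_cov H i j)"
        by (rule form) simp
      also have "\<dots> = (\<Sum>i\<in>{1..k}. \<Sum>j\<in>{1..k}. ?d (Suc i) * ?d (Suc j) * fgn_cov H (Suc i) (Suc j))"
        using d(1) by (subst S, simp, intro sum.cong refl S) simp
      also have "\<dots> = (\<Sum>i\<in>{1..k}. \<Sum>j\<in>{1..k}. ?e i * ?e j * fgn_cov H i j)"
        by (intro sum.cong refl arg_cong2[where f="(*)"] d) (auto simp: fgn_cov_def)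
      also have "\<dots> = err k c" using k by (intro form[symmetric]) simp
      finally show ?thesis .
    qed
    finally show ?thesis unfolding c .
  qed
  have bound: "?C \<le> r k" if "2 \<le> k" for k using attained[OF that] lower[of k] that by auto
  \<comment> \<open>The shift by 2 keeps every index in the range where \<open>r\<close> is given as
    a conditional variance; it does not affect the limit.\<close>
  have "decseq (\<lambda>n. r (n + 2))" by (rule decseq_SucI) (use dec in simp)
  then obtain L where L: "(\<lambda>n. r (n + 2)) \<longlonglongrightarrow> L"
    by (rule decseq_convergent[of _ ?C]) (use bound in auto)
  then have "?C \<le> L" by (rule LIMSEQ_le_const) (use bound in auto)
  moreover have "r \<longlonglongrightarrow> L" using L by (rule LIMSEQ_offset)
  ultimately show ?thesis by blast
qed

end
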